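(* Let $0<\alpha\le 1$ and $\varepsilon>0$ be constants, and let $p=p(n)$ be such that $d=d(n)=(n-1)p=n^{\alpha+o(1)}$. (i) If $\alpha=1$ and $p<1-\varepsilon$, then a.a.s. $$c_L(\mathcal{G}(n,p))=(1+o(1))\log_{1/(1-p)} n.$$ (Note that if $p=o(1)$, then $\log_{1/(1-p)} n=(1+o(1))\frac{\log n}{p}$.) (ii) If $\frac12<\alpha<1$, then a.a.s. $$c_L(\mathcal{G}(n,p))=\Theta\left(\frac{\log n}{p}\right).$$ (iii) If $\frac{1}{j+1}<\alpha<\frac1j$ for some integer $j\ge 2$, then a.a.s. $$\frac1p=O\big(c_L(\mathcal{G}(n,p))\big)\quad\text{and}\quad c_L(\mathcal{G}(n,p))=O\left(\frac{\log n}{p}\right).$$ (iv) If $\alpha=\frac1j$ for some integer $j\ge 2$, then a.a.s. $$\frac{1}{p\log^2 n}=O\big(c_L(\mathcal{G}(n,p))\big)\quad\text{and}\quad c_L(\mathcal{G}(n,p))=O\left(\frac{\log n}{p}\right).$$ In particular, in these cases, a.a.s. $c_L(\mathcal{G}(n,p))=n^{1-\alpha+o(1)}$.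
   Context: Lazy Cops and Robbers is a game played on a finite undirected graph $G$ by a set of cops and a single robber, all with full information. First the cops choose their starting vertices (several cops may share a vertex), then the robber chooses his starting vertex. Thereafter the sides alternate, cops first: on the cops' turn at most one cop moves to an adjacent vertex (the others stay put); on the robber's turn the robber moves to an adjacent vertex or stays put. The cops win if after finitely many rounds some cop occupies the same vertex as the robber; the robber wins if he can evade capture indefinitely. The lazy cop number $c_L(G)$ is the minimum number of cops that have a winning strategy on $G$. $\mathcal{G}(n,p)$ is the binomial random graph on vertex set $\{1,\dots,n\}$, in which each of the $\binom n2$ pairs is an edge independently with probability $p=p(n)$. Asymptotics are as $n\to\infty$; $\log$ is the natural logarithm; an event holds a.a.s. (asymptotically almost surely) if its probability tends to $1$ as $n\to\infty$. A statement such as "a.a.s. $X_n=O(f(n))$" means that there is a constant $C$ (not depending on $n$) such that a.a.s. $X_n\le Cf(n)$; similarly for the other asymptotic notations. For example, "a.a.s. $X_n=(1+o(1))f(n)$" means that for some deterministic sequence $\delta_n\to0$, a.a.s. $|X_n-f(n)|\le\delta_n f(n)$. *)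

theory Defs
  imports "HOL-Probability.Probability" "HOL-Library.Landau_Symbols"
begin

(* A finite undirected graph is given by its vertex set V and its set E of edges, an edge being
   a two-element subset of V. *)

definition lazy_move :: "'v set set \<Rightarrow> nat \<Rightarrow> (nat \<Rightarrow> 'v) \<Rightarrow> (nat \<Rightarrow> 'v) \<Rightarrow> bool" where
  "lazy_move E k c c' \<longleftrightarrow>
     (\<forall>i<k. c' i = c i) \<or>
     (\<exists>j<k. {c j, c' j} \<in> E \<and> (\<forall>i<k. i \<noteq> j \<longrightarrow> c' i = c i))"

(* r t is the robber's position when the cops are about to make their move number t + 1. *)
definition robber_play :: "'v set \<Rightarrow> 'v set set \<Rightarrow> (nat \<Rightarrow> 'v) \<Rightarrow> bool" where
  "robber_play V E r \<longleftrightarrow>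
     r 0 \<in> V \<and> (\<forall>t. r (Suc t) = r t \<or> {r t, r (Suc t)} \<in> E)"

(* A strategy s for k cops maps the list of the robber's positions so far to the position
   vector of the cops (entries 0, ..., k - 1): s [] is the initial placement, and
   s [r 0, ..., r t] is the placement after the cops' reply to r t.  The earlier positions of
   the cops are determined by s and this list, so this is a history-dependent strategy with
   full information. *)
definition legal_cop_strategy ::
  "'v set \<Rightarrow> 'v set set \<Rightarrow> nat \<Rightarrow> ('v list \<Rightarrow> nat \<Rightarrow> 'v) \<Rightarrow> bool" where
  "legal_cop_strategy V E k s \<longleftrightarrow>
     (\<forall>i<k. s [] i \<in> V) \<and> (\<forall>h v. lazy_move E k (s h) (s (h @ [v])))"

(* The first disjunct is capture before the cops' turn number t + 1 (the robber has just moved,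
   or been placed, onto a cop); the second is capture by that turn. *)
definition captures :: "nat \<Rightarrow> ('v list \<Rightarrow> nat \<Rightarrow> 'v) \<Rightarrow> (nat \<Rightarrow> 'v) \<Rightarrow> bool" where
  "captures k s r \<longleftrightarrow>
     (\<exists>t. \<exists>i<k. s (map r [0..<t]) i = r t \<or> s (map r [0..<Suc t]) i = r t)"

definition lazy_cops_win :: "'v set \<Rightarrow> 'v set set \<Rightarrow> nat \<Rightarrow> bool" where
  "lazy_cops_win V E k \<longleftrightarrow>
     (\<exists>s. legal_cop_strategy V E k s \<and> (\<forall>r. robber_play V E r \<longrightarrow> captures k s r))"

definition lazy_cop_number :: "'v set \<Rightarrow> 'v set set \<Rightarrow> nat" where
  "lazy_cop_number V E = (LEAST k. lazy_cops_win V E k)"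

definition vertex_pairs :: "nat \<Rightarrow> nat set set" where
  "vertex_pairs n = {e. e \<subseteq> {1..n} \<and> card e = 2}"

(* The binomial random graph on {1..n}, as a distribution on edge sets. *)
definition gnp :: "nat \<Rightarrow> real \<Rightarrow> nat set set pmf" where
  "gnp n p = map_pmf (\<lambda>f. {e \<in> vertex_pairs n. f e})
     (Pi_pmf (vertex_pairs n) False (\<lambda>_. bernoulli_pmf p))"

definition aas :: "(nat \<Rightarrow> real) \<Rightarrow> (nat \<Rightarrow> nat set set \<Rightarrow> bool) \<Rightarrow> bool" where
  "aas p Q \<longleftrightarrow> (\<lambda>n. measure_pmf.prob (gnp n (p n)) {E. Q n E}) \<longlonglongrightarrow> 1"

definition cL :: "nat \<Rightarrow> nat set set \<Rightarrow> real" where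
  "cL n E = real (lazy_cop_number {1..n} E)"

end

theory Submission
  imports Defs "HOL-Real_Asymp.Real_Asymp"
begin

text \<open>Upper bounds: a fixed set of \<open>k\<close> vertices is a.a.s. dominating as soon as
  \<open>n * (1 - p) ^ k\<close> tends to 0, and cops on a dominating set win with one move.

  Lower bound for \<open>\<alpha> > 1 / 2\<close>: by a union bound, for all vertices \<open>v\<close> and all sets of \<open>k\<close>
  vertices not containing \<open>v\<close>, some neighbour of \<open>v\<close> is neither in the set nor adjacent to it;
  the robber moves there.

  Lower bound for \<open>\<alpha> \<le> 1 / 2\<close>: give a cop at distance \<open>i\<close> from the robber a weight of order
  \<open>(C / d) ^ i\<close>, cut off at distance about \<open>1 / \<alpha>\<close>.  As only one cop moves per round, the cops'
  turn adds at most the weight of one cop at distance 1 to the total.  Few neighbours \<open>u\<close> of \<open>v\<close> are closer to a given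
  cop than \<open>v\<close> is, so averaging over all neighbours shows that some move of the robber brings the
  total back below that weight, so that all cops are again at distance at least 2.\<close>

section \<open>The game\<close>

text \<open>A union bound over cop positions costs about \<open>n ^ k\<close> with \<open>k\<close>
  of order \<open>ln n / p\<close>, while \<open>k\<close> fixed cops block every escape from a
  fixed vertex with probability about exp(- n p (1 - p)^k). The second factor wins only if n p^2 is
  polynomially large, which is \<alpha> > 1/2. Below that the potential is used because it is a sum
  over the cops: only single pairs (v, c) have to be controlled, about n^2 events. The obstacle is
  then dependence, since the ball around \<open>c\<close> may be built from edges at
  \<open>v\<close>. Deleting \<open>v\<close> removes it: a shortest walk from \<open>c\<close> to a
  neighbour of \<open>v\<close> meets \<open>v\<close> only if \<open>v\<close> is closer to
  \<open>c\<close> than that neighbour. The number of neighbours of \<open>v\<close> in a ball of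
  radius \<open>l\<close> has mean of order at most d^(l+1) / n. If this is polynomially small, one
  constant bounds it for all pairs at once; if it is large, a multiple of the mean does. At \<alpha>
  = 1/j the mean at radius j - 1 may fall between the two regimes, where the available bounds differ
  by logarithms; this is the source of the factor (ln n)^2.\<close>

lemma lazy_cops_win_if_dominating:
  assumes c: "\<And>i. i < k \<Longrightarrow> c i \<in> V"
    and dom: "\<And>v. v \<in> V \<Longrightarrow> \<exists>i<k. c i = v \<or> {c i, v} \<in> E"
  shows "lazy_cops_win V E k"
proof -
  define reply where "reply v = (if (\<exists>i<k. c i = v) then c
     else c ((SOME i. i < k \<and> {c i, v} \<in> E) := v))" for v
  \<comment> \<open>Only the robber's first position matters; after the reply to it the cops stand
    still. The test \<open>v \<in> V\<close> keeps the strategy legal on histories that no play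
    produces.\<close>
  define s where "s h = (case h of [] \<Rightarrow> c | v # h' \<Rightarrow> if v \<in> V then reply v else c)" for h
  have some: "(SOME i. i < k \<and> {c i, v} \<in> E) < k \<and> {c (SOME i. i < k \<and> {c i, v} \<in> E), v} \<in> E"
    if "v \<in> V" "\<not> (\<exists>i<k. c i = v)" for v
    using someI_ex[of "\<lambda>i. i < k \<and> {c i, v} \<in> E"] dom[OF that(1)] that(2) by blast
  have reply: "lazy_move E k c (reply v) \<and> (\<exists>i<k. reply v i = v)" if "v \<in> V" for v
    using some[OF that] by (auto simp: reply_def lazy_move_def)
  have "lazy_move E k (s h) (s (h @ [v]))" for h v
    using reply by (cases h) (auto simp: s_def lazy_move_def)
  then have "legal_cop_strategy V E k s"
    using c by (auto simp: legal_cop_strategy_def s_def)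
  moreover have "captures k s r" if "robber_play V E r" for r
  proof -
    have "r 0 \<in> V" using that by (simp add: robber_play_def)
    then have "\<exists>i<k. s (map r [0..<Suc 0]) i = r 0"
      using reply[of "r 0"] by (simp add: s_def)
    then show ?thesis unfolding captures_def by blast
  qed
  ultimately show ?thesis unfolding lazy_cops_win_def by blast
qed

text \<open>Makes the set of winning \<open>k\<close> nonempty, so that the \<open>LEAST\<close> in
  \<open>lazy_cop_number\<close> is attained.\<close>

lemma lazy_cops_win_card:
  assumes "finite V"
  shows "lazy_cops_win V E (card V)"
proof -
  obtain c where "bij_betw c {0..<card V} V" using ex_bij_betw_nat_finite[OF assms] by blast
  then have *: "c ` {0..<card V} = V" by (simp add: bij_betw_def)
  show ?thesis
  proof (rule lazy_cops_win_if_dominating[of _ c])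
    show "c i \<in> V" if "i < card V" for i using that by (subst *[symmetric]) auto
    show "\<exists>i<card V. c i = v \<or> {c i, v} \<in> E" if "v \<in> V" for v
      using that by (subst (asm) *[symmetric]) auto
  qed
qed

lemma lazy_cop_number_ge:
  assumes "finite V" "\<And>k. real k \<le> x \<Longrightarrow> \<not> lazy_cops_win V E k"
  shows "x \<le> real (lazy_cop_number V E)"
proof -
  have "lazy_cops_win V E (lazy_cop_number V E)"
    unfolding lazy_cop_number_def using lazy_cops_win_card[OF assms(1)] by (rule LeastI)
  then show ?thesis using assms(2) by force
qed

text \<open>\<open>I v c\<close> is an invariant of positions with the cops to move;
  \<open>step\<close> covers one cop move together with the robber's answer. Against a fixed
  strategy the answers, picked by \<open>SOME\<close>, form one infinite play without
  capture.\<close>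

lemma robber_escapes:
  assumes edges: "\<Union>E \<subseteq> V"
    and init: "\<And>c. (\<forall>i<k. c i \<in> V) \<Longrightarrow> \<exists>v\<in>V. I v c"
    and safe: "\<And>v c. I v c \<Longrightarrow> \<forall>i<k. c i \<noteq> v"
    and step: "\<And>v c c'. I v c \<Longrightarrow> v \<in> V \<Longrightarrow> (\<forall>i<k. c i \<in> V) \<Longrightarrow> (\<forall>i<k. c' i \<in> V) \<Longrightarrow>
      lazy_move E k c c' \<Longrightarrow> (\<forall>i<k. c' i \<noteq> v) \<and> (\<exists>u\<in>V. (u = v \<or> {v, u} \<in> E) \<and> I u c')"
  shows "\<not> lazy_cops_win V E k"
proof
  assume "lazy_cops_win V E k"
  then obtain s where s: "legal_cop_strategy V E k s"
    and cap: "\<And>r. robber_play V E r \<Longrightarrow> captures k s r"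
    unfolding lazy_cops_win_def by blast
  have mv: "lazy_move E k (s h) (s (h @ [v]))" for h v
    using s by (auto simp: legal_cop_strategy_def)
  have sV: "\<forall>i<k. s h i \<in> V" for h
  proof (induction h rule: rev_induct)
    case Nil then show ?case using s by (auto simp: legal_cop_strategy_def)
  next
    case (snoc v h)
    show ?case
    proof (intro allI impI)
      fix i assume i: "i < k"
      consider "s (h @ [v]) i = s h i" | "{s h i, s (h @ [v]) i} \<in> E"
        using mv[of h v] i unfolding lazy_move_def by metis
      then show "s (h @ [v]) i \<in> V" using snoc i edges by cases auto
    qed
  qed
  obtain v0 where v0: "v0 \<in> V" "I v0 (s [])" using init[OF sV] by blast
  define nxt where "nxt v c = (SOME u. u \<in> V \<and> (u = v \<or> {v, u} \<in> E) \<and> I u c)" for v c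
  \<comment> \<open>The recursion carries the whole history r 0, ..., r t, because the strategy may
    read all of it.\<close>
  define h where "h = rec_nat [v0] (\<lambda>_ l. l @ [nxt (last l) (s l)])"
  define r where "r t = last (h t)" for t
  have h0: "h 0 = [v0]" and hS: "\<And>t. h (Suc t) = h t @ [nxt (r t) (s (h t))]"
    by (simp_all add: h_def r_def)
  have hr: "map r [0..<Suc t] = h t" for t
  proof (induction t)
    case 0 then show ?case by (simp add: r_def h0)
  next
    case (Suc t)
    have "map r [0..<Suc (Suc t)] = h t @ [r (Suc t)]" using Suc by simp
    also have "\<dots> = h (Suc t)" by (simp add: r_def hS)
    finally show ?case .
  qed
  have snocr: "map r [0..<Suc t] = map r [0..<t] @ [r t]" for t by simp
  have move: "(\<forall>i<k. s (map r [0..<Suc t]) i \<noteq> r t) \<and> r (Suc t) \<in> V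
       \<and> (r (Suc t) = r t \<or> {r t, r (Suc t)} \<in> E) \<and> I (r (Suc t)) (s (map r [0..<Suc t]))"
    if I: "r t \<in> V" "I (r t) (s (map r [0..<t]))" for t
  proof -
    have "(\<forall>i<k. s (map r [0..<Suc t]) i \<noteq> r t) \<and>
        (\<exists>u\<in>V. (u = r t \<or> {r t, u} \<in> E) \<and> I u (s (map r [0..<Suc t])))"
      using step[OF I(2,1) sV sV] mv[of "map r [0..<t]" "r t"] unfolding snocr by blast
    moreover have "r (Suc t) = nxt (r t) (s (map r [0..<Suc t]))"
      unfolding hr by (simp add: r_def hS)
    moreover from calculation(1) have
      "\<exists>u. u \<in> V \<and> (u = r t \<or> {r t, u} \<in> E) \<and> I u (s (map r [0..<Suc t]))" by blast
    ultimately show ?thesis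
      using someI_ex[of "\<lambda>u. u \<in> V \<and> (u = r t \<or> {r t, u} \<in> E) \<and> I u (s (map r [0..<Suc t]))"]
      unfolding nxt_def by simp
  qed
  have inv: "r t \<in> V \<and> I (r t) (s (map r [0..<t]))" for t
  proof (induction t)
    case 0 then show ?case using v0 by (simp add: r_def h0)
  next
    case (Suc t) then show ?case using move[of t] by blast
  qed
  have "robber_play V E r"
    using inv move unfolding robber_play_def by blast
  then obtain t i where "i < k" "s (map r [0..<t]) i = r t \<or> s (map r [0..<Suc t]) i = r t"
    using cap[of r] unfolding captures_def by blast
  moreover have "s (map r [0..<t]) i \<noteq> r t" using safe inv[of t] \<open>i < k\<close> by blast
  moreover have "s (map r [0..<Suc t]) i \<noteq> r t" using move[of t] inv[of t] \<open>i < k\<close> by blast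
  ultimately show False by blast
qed

section \<open>Neighbourhoods, balls and vertex deletion\<close>

definition nbrs :: "'v set set \<Rightarrow> 'v \<Rightarrow> 'v set" where
  "nbrs E v = {u. {v, u} \<in> E}"

primrec gball :: "'v set set \<Rightarrow> nat \<Rightarrow> 'v \<Rightarrow> 'v set" where
  "gball E 0 c = {c}"
| "gball E (Suc i) c = gball E i c \<union> (\<Union>y\<in>gball E i c. nbrs E y)"

text \<open>The vertex becomes isolated instead of disappearing, so \<open>nbrs\<close> and
  \<open>gball\<close> apply unchanged. In the random graph the edges kept are independent of those
  at \<open>v\<close>.\<close>

definition del_vertex :: "'v \<Rightarrow> 'v set set \<Rightarrow> 'v set set" where
  "del_vertex v E = {e \<in> E. v \<notin> e}"

lemma nbrs_sym: "u \<in> nbrs E v \<longleftrightarrow> v \<in> nbrs E u"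
  by (simp add: nbrs_def insert_commute)

lemma nbrs_subset: "\<Union>E \<subseteq> V \<Longrightarrow> nbrs E v \<subseteq> V"
  by (auto simp: nbrs_def)

lemma gball_subset: "\<Union>E \<subseteq> V \<Longrightarrow> c \<in> V \<Longrightarrow> gball E i c \<subseteq> V"
  by (induction i) (use nbrs_subset[of E V] in \<open>auto, blast\<close>)

lemma gball_mono: "i \<le> j \<Longrightarrow> gball E i c \<subseteq> gball E j c"
  by (rule lift_Suc_mono_le) auto

text \<open>A walk of length at most \<open>i\<close> through \<open>v\<close> would put
  \<open>v\<close> into the ball, so every edge used in building the ball survives the
  deletion.\<close>

lemma gball_del_vertex:
  assumes "v \<notin> gball E i c"
  shows "gball E i c \<subseteq> gball (del_vertex v E) i c"
  using assms
proof (induction i)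
  case 0 then show ?case by simp
next
  case (Suc i)
  then have IH: "gball E i c \<subseteq> gball (del_vertex v E) i c" by auto
  have "x \<in> nbrs (del_vertex v E) y" if "y \<in> gball E i c" "x \<in> nbrs E y" for x y
    using Suc.prems that by (auto simp: nbrs_def del_vertex_def)
  then show ?case using IH by fastforce
qed

text \<open>A walk of length at most \<open>i\<close> from \<open>c\<close> to a neighbour of \<open>v\<close> avoids \<open>v\<close> unless \<open>v\<close> is
  already within distance \<open>i - 1\<close> of \<open>c\<close>.\<close>

lemma nbrs_gball_del_vertex:
  assumes "\<And>l. Suc l = i \<Longrightarrow> v \<notin> gball E l c" "v \<notin> nbrs E v"
  shows "nbrs E v \<inter> gball E i c \<subseteq> nbrs E v \<inter> gball (del_vertex v E) i c"
proof (cases i)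
  case 0 then show ?thesis by simp
next
  case (Suc l)
  then have v: "v \<notin> gball E l c" using assms by simp
  have "x \<in> gball (del_vertex v E) (Suc l) c" if x: "x \<in> gball E (Suc l) c" "x \<in> nbrs E v" for x
  proof (cases "x \<in> gball E l c")
    case True then show ?thesis using gball_del_vertex[OF v] by auto
  next
    case False
    then obtain y where y: "y \<in> gball E l c" "x \<in> nbrs E y" using x by auto
    moreover have "x \<in> nbrs (del_vertex v E) y"
      using y v x assms(2) by (auto simp: nbrs_def del_vertex_def)
    ultimately show ?thesis using gball_del_vertex[OF v] by auto
  qed
  then show ?thesis using Suc by auto
qed

lemma card_gball_le:
  assumes fin: "finite V" and edges: "\<Union>E \<subseteq> V" and c: "c \<in> V"
    and deg: "\<And>v. v \<in> V \<Longrightarrow> real (card (nbrs E v)) \<le> \<Delta>"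
  shows "real (card (gball E i c)) \<le> (1 + \<Delta>) ^ i"
proof (induction i)
  case 0 then show ?case by simp
next
  case (Suc i)
  have sub: "gball E i c \<subseteq> V" using gball_subset[OF edges c] .
  then have fb: "finite (gball E i c)" using fin finite_subset by blast
  have \<Delta>: "0 \<le> \<Delta>" using deg[OF c] by (meson of_nat_0_le_iff order_trans)
  have "card (gball E (Suc i) c) \<le> card (gball E i c) + card (\<Union>y\<in>gball E i c. nbrs E y)"
    by (simp add: card_Un_le)
  also have "\<dots> \<le> card (gball E i c) + (\<Sum>y\<in>gball E i c. card (nbrs E y))"
    using card_UN_le[OF fb] by simp
  finally have "real (card (gball E (Suc i) c))
      \<le> real (card (gball E i c)) + (\<Sum>y\<in>gball E i c. real (card (nbrs E y)))"
    unfolding of_nat_sum[symmetric] of_nat_add[symmetric] of_nat_le_iff .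
  also have "\<dots> \<le> real (card (gball E i c)) + (\<Sum>y\<in>gball E i c. \<Delta>)"
    by (intro add_left_mono sum_mono) (use deg sub in auto)
  also have "\<dots> = real (card (gball E i c)) * (1 + \<Delta>)" by (simp add: algebra_simps)
  also have "\<dots> \<le> (1 + \<Delta>) ^ i * (1 + \<Delta>)"
    using Suc \<Delta> by (intro mult_right_mono) auto
  finally show ?case by (simp add: mult.commute)
qed

section \<open>Potential functions for the robber\<close>

text \<open>Invariant: with the cops to move, the total potential is below \<open>W\<close>, so by
  \<open>near\<close> every cop is at distance at least 2. A lazy move raises the total to less than
  2 W (\<open>far\<close>); the average over the neighbours of \<open>v\<close> is then less than 2
  W / 4 + k \<beta> \<le> W, so some neighbour restores the invariant. \<open>\<beta>\<close> pays
  for cops that come inside the cut-off radius when the robber moves.\<close>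

lemma robber_wins_potential:
  fixes \<phi> :: "'v \<Rightarrow> 'v \<Rightarrow> real"
  assumes fin: "finite V" "V \<noteq> {}" and edges: "\<Union>E \<subseteq> V"
    and nonneg: "\<And>v c. 0 \<le> \<phi> v c"
    and near: "\<And>v c. v \<in> V \<Longrightarrow> c \<in> V \<Longrightarrow> v = c \<or> {v, c} \<in> E \<Longrightarrow> W \<le> \<phi> v c"
    and far: "\<And>v c. v \<in> V \<Longrightarrow> c \<in> V \<Longrightarrow> v \<noteq> c \<Longrightarrow> \<phi> v c \<le> W"
    and deg: "\<And>v. v \<in> V \<Longrightarrow> nbrs E v \<noteq> {}"
    and avg: "\<And>v c. v \<in> V \<Longrightarrow> c \<in> V \<Longrightarrow> v \<noteq> c \<Longrightarrow>
      (\<Sum>u\<in>nbrs E v. \<phi> u c) \<le> real (card (nbrs E v)) * (\<phi> v c / 4 + \<beta>)"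
    and k\<beta>: "real k * \<beta> \<le> W / 2"
    and total: "\<And>c. c \<in> V \<Longrightarrow> (\<Sum>v\<in>V. \<phi> v c) \<le> B"
    and kB: "real k * B < real (card V) * W"
  shows "\<not> lazy_cops_win V E k"
proof (rule robber_escapes[where I = "\<lambda>v c. v \<in> V \<and> (\<forall>i<k. c i \<in> V) \<and> (\<Sum>i<k. \<phi> v (c i)) < W"])
  show "\<Union>E \<subseteq> V" by fact
next
  fix c assume c: "\<forall>i<k. c i \<in> V"
  show "\<exists>v\<in>V. v \<in> V \<and> (\<forall>i<k. c i \<in> V) \<and> (\<Sum>i<k. \<phi> v (c i)) < W"
  proof (rule ccontr)
    \<comment> \<open>Averaging over starting vertices: if all were bad, the potential summed over
      \<open>V\<close> would be at least |V| W, against \<open>total\<close> and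
      \<open>kB\<close>.\<close>
    assume "\<not> ?thesis"
    then have "W \<le> (\<Sum>i<k. \<phi> v (c i))" if "v \<in> V" for v using that c by force
    then have "real (card V) * W \<le> (\<Sum>v\<in>V. \<Sum>i<k. \<phi> v (c i))"
      by (intro sum_bounded_below) simp
    also have "\<dots> = (\<Sum>i<k. \<Sum>v\<in>V. \<phi> v (c i))" by (rule sum.swap)
    also have "\<dots> \<le> (\<Sum>i<k. B)" by (intro sum_mono total) (use c in auto)
    finally show False using kB by simp
  qed
next
  have single: "\<phi> v (c i) \<le> (\<Sum>i<k. \<phi> v (c i))" if "i < k" for v c i
    using that nonneg by (intro member_le_sum) auto
  {
    fix v c assume I: "v \<in> V \<and> (\<forall>i<k. c i \<in> V) \<and> (\<Sum>i<k. \<phi> v (c i)) < W"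
    then have "\<phi> v (c i) < W" if "i < k" for i
      using single[OF that, of v c] by linarith
    then have "\<forall>i<k. c i \<noteq> v \<and> {v, c i} \<notin> E" using near I by (metis linorder_not_less)
  } note sep = this
  show "\<forall>i<k. c i \<noteq> v" if "v \<in> V \<and> (\<forall>i<k. c i \<in> V) \<and> (\<Sum>i<k. \<phi> v (c i)) < W" for v c
    using sep[OF that] by blast
  fix v c c'
  assume I: "v \<in> V \<and> (\<forall>i<k. c i \<in> V) \<and> (\<Sum>i<k. \<phi> v (c i)) < W"
    and "v \<in> V" "\<forall>i<k. c i \<in> V" and c': "\<forall>i<k. c' i \<in> V" and move: "lazy_move E k c c'"
  have W: "0 < W"
    using I nonneg by (meson le_less_trans sum_nonneg)
  \<comment> \<open>No cop was within distance 1 of \<open>v\<close>, so the moving cop cannot land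
    on \<open>v\<close>, and \<open>far\<close> applies to its new vertex.\<close>
  have free: "c' i \<noteq> v" if "i < k" for i
    using move sep[OF I] that unfolding lazy_move_def by (metis insert_commute)
  have "(\<Sum>i<k. \<phi> v (c' i)) < 2 * W"
  proof (cases "\<forall>i<k. c' i = c i")
    case True
    then have "(\<Sum>i<k. \<phi> v (c' i)) = (\<Sum>i<k. \<phi> v (c i))" by (intro sum.cong) auto
    then show ?thesis using I W by linarith
  next
    case False
    then obtain j where j: "j < k" "\<forall>i<k. i \<noteq> j \<longrightarrow> c' i = c i"
      using move unfolding lazy_move_def by blast
    have "(\<Sum>i<k. \<phi> v (c' i)) = \<phi> v (c' j) + (\<Sum>i\<in>{..<k} - {j}. \<phi> v (c' i))"
      using j by (intro sum.remove) auto
    also have "\<dots> \<le> W + (\<Sum>i\<in>{..<k} - {j}. \<phi> v (c i))"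
      using far[of v "c' j"] free[OF j(1)] c' j I by (intro add_mono) (auto intro!: sum_mono)
    also have "\<dots> \<le> W + (\<Sum>i<k. \<phi> v (c i))"
      using nonneg by (intro add_left_mono sum_mono2) auto
    also have "\<dots> < 2 * W" using I by simp
    finally show ?thesis .
  qed
  then have lt: "(\<Sum>i<k. \<phi> v (c' i)) / 4 + real k * \<beta> < W" using k\<beta> by linarith
  have "\<exists>u\<in>nbrs E v. (\<Sum>i<k. \<phi> u (c' i)) < W"
  proof (rule ccontr)
    have fn: "finite (nbrs E v)" by (rule finite_subset[OF nbrs_subset[OF edges] fin(1)])
    then have pos: "0 < real (card (nbrs E v))" using deg[of v] I by (simp add: card_gt_0_iff)
    assume "\<not> ?thesis"
    then have "real (card (nbrs E v)) * W \<le> (\<Sum>u\<in>nbrs E v. \<Sum>i<k. \<phi> u (c' i))"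
      by (intro sum_bounded_below) force
    also have "\<dots> = (\<Sum>i<k. \<Sum>u\<in>nbrs E v. \<phi> u (c' i))" by (rule sum.swap)
    also have "\<dots> \<le> (\<Sum>i<k. real (card (nbrs E v)) * (\<phi> v (c' i) / 4 + \<beta>))"
      by (intro sum_mono avg) (use I c' free in auto)
    also have "\<dots> = real (card (nbrs E v)) * ((\<Sum>i<k. \<phi> v (c' i)) / 4 + real k * \<beta>)"
      by (simp add: sum.distrib sum_distrib_left sum_divide_distrib algebra_simps)
    also have "\<dots> < real (card (nbrs E v)) * W" using pos lt by simp
    finally show False by simp
  qed
  then show "(\<forall>i<k. c' i \<noteq> v) \<and> (\<exists>u\<in>V. (u = v \<or> {v, u} \<in> E) \<and>
      (u \<in> V \<and> (\<forall>i<k. c' i \<in> V) \<and> (\<Sum>i<k. \<phi> u (c' i)) < W))"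
    using free c' nbrs_subset[OF edges, of v] by (auto simp: nbrs_def)
qed

text \<open>The potential of a cop at \<open>c\<close> is \<open>\<Sum>l\<le>J. a l * of_bool (v \<in> gball E l c)\<close>, a nonincreasing
  function of its distance from the robber's vertex \<open>v\<close>.  Moving to a random neighbour turns the
  weight \<open>a l\<close> into a fraction \<open>K (l - 1) / D\<close> of \<open>a (l - 1)\<close>, plus \<open>a (l + 1)\<close>; the
  geometric decay of the weights makes the sum a contraction.\<close>

lemma robber_wins_layers:
  fixes a K :: "nat \<Rightarrow> real"
  assumes fin: "finite V" "V \<noteq> {}" and edges: "\<Union>E \<subseteq> V" and loopless: "\<And>v. {v} \<notin> E"
    and D: "0 < D" and deg: "\<And>v. v \<in> V \<Longrightarrow> D \<le> real (card (nbrs E v)) \<and> real (card (nbrs E v)) \<le> \<Delta>"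
    and cnt: "\<And>l v c. l \<le> J \<Longrightarrow> v \<in> V \<Longrightarrow> c \<in> V \<Longrightarrow> v \<noteq> c \<Longrightarrow>
      real (card (nbrs E v \<inter> gball (del_vertex v E) l c)) \<le> K l"
    and a: "\<And>l. 0 \<le> a l" and K: "\<And>l. 0 \<le> K l" and J: "1 \<le> J"
    and decay: "\<And>l. l < J \<Longrightarrow> 8 * a (Suc l) \<le> a l"
    and contract: "\<And>l. l < J \<Longrightarrow> 8 * a l * K l \<le> D * a (Suc l)"
    and outer: "2 * real k * (a J * K J) \<le> D * a 1"
    and init: "real k * (\<Sum>l\<le>J. a l * (1 + \<Delta>) ^ l) < real (card V) * a 1"
  shows "\<not> lazy_cops_win V E k"
proof -
  define \<phi> where "\<phi> v c = (\<Sum>l\<le>J. a l * of_bool (v \<in> gball E l c))" for v c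
  \<comment> \<open>The potential of a cop at distance exactly 1, which misses only the ball of
    radius 0.\<close>
  define W where "W = (\<Sum>l\<in>{1..J}. a l)"
  have a1W: "a 1 \<le> W" unfolding W_def using J a by (intro member_le_sum) auto
  have split0: "{..J} = insert 0 {1..J}" by auto
  have nonneg: "0 \<le> \<phi> v c" for v c unfolding \<phi>_def using a by (intro sum_nonneg) auto
  have near: "W \<le> \<phi> v c" if "v = c \<or> {v, c} \<in> E" for v c
  proof -
    have "v \<in> gball E 1 c" using that by (auto simp: nbrs_def insert_commute)
    then have "v \<in> gball E l c" if "l \<in> {1..J}" for l using gball_mono[of 1 l E c] that by auto
    then have "W = (\<Sum>l\<in>{1..J}. a l * of_bool (v \<in> gball E l c))" unfolding W_def by simp
    also have "\<dots> \<le> \<phi> v c" unfolding \<phi>_def using a by (intro sum_mono2) auto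
    finally show ?thesis .
  qed
  have far: "\<phi> v c \<le> W" if "v \<noteq> c" for v c
  proof -
    have "\<phi> v c = (\<Sum>l\<in>{1..J}. a l * of_bool (v \<in> gball E l c))"
      unfolding \<phi>_def split0 using that by simp
    also have "\<dots> \<le> W" unfolding W_def using a by (intro sum_mono) auto
    finally show ?thesis .
  qed
  have finb: "finite (gball E l c)" "finite (nbrs E c)" if "c \<in> V" for l c
    by (rule finite_subset[OF gball_subset[OF edges that] fin(1)],
        rule finite_subset[OF nbrs_subset[OF edges] fin(1)])
  have avg: "(\<Sum>u\<in>nbrs E v. \<phi> u c) \<le> real (card (nbrs E v)) * (\<phi> v c / 4 + a J * K J / D)"
    if v: "v \<in> V" and c: "c \<in> V" and ne: "v \<noteq> c" for v c
  proof -
    define d where "d = real (card (nbrs E v))"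
    define ind where "ind l = (of_bool (v \<in> gball E l c) :: real)" for l
    have dD: "D \<le> d" using deg[OF v] by (simp add: d_def)
    then have d0: "0 < d" using D by simp
    \<comment> \<open>Three ranges for the distance from \<open>c\<close> to \<open>v\<close>: up to
      l - 1, all neighbours of \<open>v\<close> may lie in the ball; at l or l + 1, at most
      \<open>K l\<close> of them do, by deleting \<open>v\<close>; beyond l + 1, none. The potential
      has no layer J + 1, so for l = J the indicator is replaced by 1, and this term becomes
      \<open>\<beta>\<close>.\<close>
    have count: "real (card (nbrs E v \<inter> gball E l c)) \<le> d * (if l = 0 then 0 else ind (l - 1)) +
        K l * (if l < J then ind (Suc l) else 1)" if l: "l \<le> J" for l
    proof (cases "l \<noteq> 0 \<and> v \<in> gball E (l - 1) c")
      case True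
      have "real (card (nbrs E v \<inter> gball E l c)) \<le> d"
        unfolding d_def using finb[OF v] by (simp add: card_mono)
      then show ?thesis using True K[of l] by (simp add: ind_def)
    next
      case False
      have "nbrs E v \<inter> gball E l c \<subseteq> nbrs E v \<inter> gball (del_vertex v E) l c"
        using False by (intro nbrs_gball_del_vertex) (auto simp: nbrs_def loopless)
      then have "card (nbrs E v \<inter> gball E l c) \<le> card (nbrs E v \<inter> gball (del_vertex v E) l c)"
        using finb[OF v] by (intro card_mono) auto
      then have *: "real (card (nbrs E v \<inter> gball E l c)) \<le> K l"
        using cnt[OF l v c ne] by linarith
      show ?thesis
      proof (cases "v \<in> gball E (Suc l) c")
        case True
        then show ?thesis using * False by (auto simp: ind_def)
      next
        case f: False
        then have "nbrs E v \<inter> gball E l c = {}" using nbrs_sym[of _ E v] by auto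
        then show ?thesis using K[of l] d0 by (simp add: ind_def)
      qed
    qed
    have "(\<Sum>u\<in>nbrs E v. \<phi> u c) = (\<Sum>l\<le>J. \<Sum>u\<in>nbrs E v. a l * of_bool (u \<in> gball E l c))"
      unfolding \<phi>_def by (rule sum.swap)
    also have "\<dots> = (\<Sum>l\<le>J. a l * real (card (nbrs E v \<inter> gball E l c)))"
      using finb[OF v] by (simp add: sum_distrib_left[symmetric] Int_def)
    also have "\<dots> \<le> (\<Sum>l\<le>J. a l * (d * (if l = 0 then 0 else ind (l - 1)) +
        K l * (if l < J then ind (Suc l) else 1)))"
      by (intro sum_mono mult_left_mono count a) auto
    also have "\<dots> = (\<Sum>l\<le>J. d * a l * (if l = 0 then 0 else ind (l - 1))) +
        (\<Sum>l\<le>J. a l * K l * (if l < J then ind (Suc l) else 1))"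
      by (simp add: sum.distrib algebra_simps)
    also have "(\<Sum>l\<le>J. d * a l * (if l = 0 then 0 else ind (l - 1))) = (\<Sum>l<J. d * a (Suc l) * ind l)"
      by (subst sum.atMost_shift) simp
    also have "(\<Sum>l\<le>J. a l * K l * (if l < J then ind (Suc l) else 1)) =
        (\<Sum>l<J. a l * K l * ind (Suc l)) + a J * K J"
      by (simp add: lessThan_Suc_atMost[symmetric])
    \<comment> \<open>\<open>decay\<close> bounds this sum and \<open>contract\<close> the other
      one, each by d / 8 times the potential; together they give the factor 1/4 required of the
      average.\<close>
    also have "(\<Sum>l<J. d * a (Suc l) * ind l) \<le> (\<Sum>l<J. d / 8 * (a l * ind l))"
    proof (rule sum_mono)
      fix l assume "l \<in> {..<J}"
      then have "8 * a (Suc l) \<le> a l" using decay by simp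
      then have "d * ind l * (8 * a (Suc l)) \<le> d * ind l * a l"
        using d0 by (intro mult_left_mono) (auto simp: ind_def)
      then show "d * a (Suc l) * ind l \<le> d / 8 * (a l * ind l)" by (simp add: algebra_simps)
    qed
    also have "\<dots> \<le> d / 8 * \<phi> v c"
      unfolding \<phi>_def ind_def sum_distrib_left[symmetric] using a d0
      by (intro mult_left_mono sum_mono2) auto
    also have "(\<Sum>l<J. a l * K l * ind (Suc l)) \<le> (\<Sum>l<J. d / 8 * (a (Suc l) * ind (Suc l)))"
    proof (rule sum_mono)
      fix l assume "l \<in> {..<J}"
      then have "8 * a l * K l \<le> D * a (Suc l)" using contract by simp
      also have "\<dots> \<le> d * a (Suc l)" using dD a by (intro mult_right_mono) auto
      finally have "ind (Suc l) * (8 * a l * K l) \<le> ind (Suc l) * (d * a (Suc l))"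
        by (intro mult_left_mono) (auto simp: ind_def)
      then show "a l * K l * ind (Suc l) \<le> d / 8 * (a (Suc l) * ind (Suc l))"
        by (simp add: algebra_simps)
    qed
    also have "\<dots> \<le> d / 8 * \<phi> v c"
    proof -
      have "(\<Sum>l<J. a (Suc l) * ind (Suc l)) \<le> \<phi> v c"
        unfolding \<phi>_def ind_def using a by (subst sum.atMost_shift) simp
      then show ?thesis unfolding sum_distrib_left[symmetric] using d0 by simp
    qed
    also have "a J * K J \<le> d * (a J * K J / D)"
    proof -
      have "D * (a J * K J / D) \<le> d * (a J * K J / D)"
        using dD a K D by (intro mult_right_mono) auto
      then show ?thesis using D by simp
    qed
    finally show ?thesis unfolding d_def[symmetric] by (simp add: algebra_simps)
  qed
  have total: "(\<Sum>v\<in>V. \<phi> v c) \<le> (\<Sum>l\<le>J. a l * (1 + \<Delta>) ^ l)" if c: "c \<in> V" for c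
  proof -
    have "(\<Sum>v\<in>V. \<phi> v c) = (\<Sum>l\<le>J. \<Sum>v\<in>V. a l * of_bool (v \<in> gball E l c))"
      unfolding \<phi>_def by (rule sum.swap)
    also have "\<dots> = (\<Sum>l\<le>J. a l * real (card (V \<inter> gball E l c)))"
      using fin by (simp add: sum_distrib_left[symmetric] Int_def)
    also have "\<dots> = (\<Sum>l\<le>J. a l * real (card (gball E l c)))"
      using gball_subset[OF edges c] by (simp add: Int_absorb1)
    also have "\<dots> \<le> (\<Sum>l\<le>J. a l * (1 + \<Delta>) ^ l)"
      by (intro sum_mono mult_left_mono a card_gball_le[OF fin(1) edges c]) (use deg in auto)
    finally show ?thesis .
  qed
  show ?thesis
  proof (rule robber_wins_potential[OF fin edges nonneg near far _ avg _ total])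
    show "nbrs E v \<noteq> {}" if "v \<in> V" for v using deg[OF that] D by auto
    have "2 * (real k * (a J * K J / D)) \<le> a 1" using outer D by (simp add: field_simps)
    then show "real k * (a J * K J / D) \<le> W / 2" using a1W by linarith
    have "real (card V) * a 1 \<le> real (card V) * W" using a1W by (intro mult_left_mono) auto
    then show "real k * (\<Sum>l\<le>J. a l * (1 + \<Delta>) ^ l) < real (card V) * W" using init by linarith
  qed auto
qed

section \<open>Random subsets\<close>

text \<open>\<open>gnp\<close> with a free ground set, so that the law of the edges within any set
  of pairs has the same form.\<close>

definition random_subset :: "'a set \<Rightarrow> real \<Rightarrow> 'a set pmf" where
  "random_subset A p = map_pmf (\<lambda>f. {e \<in> A. f e}) (Pi_pmf A False (\<lambda>_. bernoulli_pmf p))"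

lemma gnp_random_subset: "gnp n p = random_subset (vertex_pairs n) p"
  by (simp add: gnp_def random_subset_def)

lemma random_subset_subset: "X \<in> set_pmf (random_subset A p) \<Longrightarrow> X \<subseteq> A"
  by (auto simp: random_subset_def)

lemma random_subset_restrict:
  assumes "finite A" "T \<subseteq> A"
  shows "map_pmf (\<lambda>X. X \<inter> T) (random_subset A p) = random_subset T p"
  unfolding random_subset_def Pi_pmf_subset[OF assms] pmf.map_comp
  using assms(2) by (intro arg_cong2[where f = map_pmf]) (auto simp: fun_eq_iff)

lemma random_subset_union:
  assumes "finite S" "finite T" "S \<inter> T = {}"
  shows "random_subset (S \<union> T) p =
    map_pmf (\<lambda>(X, Y). X \<union> Y) (pair_pmf (random_subset S p) (random_subset T p))"
  unfolding random_subset_def Pi_pmf_union[OF assms] map_pair[symmetric] pmf.map_comp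
  using assms(3) by (intro arg_cong2[where f = map_pmf]) (auto simp: fun_eq_iff)

lemma random_subset_split:
  assumes fin: "finite A" and S: "S \<subseteq> A" and T: "T \<subseteq> A" and disj: "S \<inter> T = {}"
  shows "map_pmf (\<lambda>X. (X \<inter> S, X \<inter> T)) (random_subset A p) =
    pair_pmf (random_subset S p) (random_subset T p)"
proof -
  have fST: "finite S" "finite T" using assms finite_subset by blast+
  have "map_pmf (\<lambda>X. (X \<inter> S, X \<inter> T)) (random_subset A p) =
      map_pmf (\<lambda>X. (X \<inter> S, X \<inter> T)) (map_pmf (\<lambda>X. X \<inter> (S \<union> T)) (random_subset A p))"
    unfolding pmf.map_comp by (intro arg_cong2[where f = map_pmf]) (auto simp: fun_eq_iff)
  also have "map_pmf (\<lambda>X. X \<inter> (S \<union> T)) (random_subset A p) = random_subset (S \<union> T) p"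
    using S T by (intro random_subset_restrict fin) auto
  also have "map_pmf (\<lambda>X. (X \<inter> S, X \<inter> T)) \<dots> =
      map_pmf id (pair_pmf (random_subset S p) (random_subset T p))"
    unfolding random_subset_union[OF fST disj] pmf.map_comp
    by (rule map_pmf_cong[OF refl])
       (use disj in \<open>auto dest!: random_subset_subset\<close>)
  finally show ?thesis by simp
qed

lemma prob_random_subset_split:
  assumes "finite A" "S \<subseteq> A" "T \<subseteq> A" "S \<inter> T = {}"
  shows "measure_pmf.prob (random_subset A p) {X. R (X \<inter> S) (X \<inter> T)} =
    measure_pmf.prob (pair_pmf (random_subset S p) (random_subset T p)) {Z. R (fst Z) (snd Z)}"
  unfolding random_subset_split[OF assms, symmetric] measure_map_pmf
  by (simp add: vimage_def)

lemma prob_random_subset_restrict: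
  assumes "finite A" "T \<subseteq> A"
  shows "measure_pmf.prob (random_subset A p) {X. P (X \<inter> T)} =
    measure_pmf.prob (random_subset T p) {X. P X}"
  unfolding random_subset_restrict[OF assms, symmetric] measure_map_pmf by (simp add: vimage_def)

lemma prob_random_subset_indep:
  assumes fin: "finite A" and S: "S \<subseteq> A" and T: "T \<subseteq> A" and disj: "S \<inter> T = {}"
  shows "measure_pmf.prob (random_subset A p) {X. P (X \<inter> S) \<and> Q (X \<inter> T)} =
    measure_pmf.prob (random_subset A p) {X. P (X \<inter> S)} *
    measure_pmf.prob (random_subset A p) {X. Q (X \<inter> T)}"
proof -
  \<comment> \<open>The product rule for \<open>pair_pmf\<close> asks for countable sets, so both
    events are cut down to the supports.\<close>
  have cnt: "countable {X. X \<subseteq> B \<and> R X}" if "B \<subseteq> A" for B and R :: "'a set \<Rightarrow> bool"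
    using fin that finite_subset by (intro countable_finite) (auto intro: finite_subset[of _ "Pow B"])
  have supp: "measure_pmf.prob (random_subset B p) {X. R X} =
      measure_pmf.prob (random_subset B p) {X. X \<subseteq> B \<and> R X}" for B R
    by (intro measure_pmf.finite_measure_eq_AE) (auto simp: AE_measure_pmf_iff dest: random_subset_subset)
  have "measure_pmf.prob (random_subset A p) {X. P (X \<inter> S) \<and> Q (X \<inter> T)} =
      measure_pmf.prob (pair_pmf (random_subset S p) (random_subset T p)) {Z. P (fst Z) \<and> Q (snd Z)}"
    using prob_random_subset_split[OF assms] .
  also have "\<dots> = measure_pmf.prob (pair_pmf (random_subset S p) (random_subset T p))
      ({X. X \<subseteq> S \<and> P X} \<times> {X. X \<subseteq> T \<and> Q X})"
    by (intro measure_pmf.finite_measure_eq_AE)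
       (auto simp: AE_measure_pmf_iff dest: random_subset_subset)
  also have "\<dots> = measure_pmf.prob (random_subset S p) {X. P X} *
      measure_pmf.prob (random_subset T p) {X. Q X}"
    using S T by (subst measure_pmf_prob_product) (auto intro: cnt simp: supp[symmetric])
  finally show ?thesis
    using prob_random_subset_restrict[OF fin S] prob_random_subset_restrict[OF fin T] by simp
qed

text \<open>Conditioning on the part in \<open>T\<close>: the event may depend on it arbitrarily,
  and a bound valid for every fixed \<open>Y\<close> survives averaging over
  \<open>Y\<close>.\<close>

lemma prob_random_subset_condition:
  assumes "finite A" "S \<subseteq> A" "T \<subseteq> A" "S \<inter> T = {}"
    and b: "\<And>Y. Y \<subseteq> T \<Longrightarrow> measure_pmf.prob (random_subset S p) {X. R X Y} \<le> b"
  shows "measure_pmf.prob (random_subset A p) {X. R (X \<inter> S) (X \<inter> T)} \<le> b"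
proof -
  have b0: "0 \<le> b" using b[of "{}"] by (meson empty_subsetI measure_nonneg order_trans)
  have "emeasure (measure_pmf (pair_pmf (random_subset S p) (random_subset T p)))
      {Z. R (fst Z) (snd Z)} =
     (\<integral>\<^sup>+Y. emeasure (measure_pmf (random_subset S p)) {X. R X Y} \<partial>random_subset T p)"
    by (subst pair_commute_pmf)
       (simp add: pair_pmf_def map_bind_pmf vimage_def map_pmf_def[symmetric] pmf.map_comp o_def)
  also have "\<dots> \<le> (\<integral>\<^sup>+Y. ennreal b \<partial>random_subset T p)"
    by (intro nn_integral_mono_AE)
       (auto simp: AE_measure_pmf_iff measure_pmf.emeasure_eq_measure b0
         intro!: ennreal_leI b dest!: random_subset_subset)
  also have "\<dots> = ennreal b" by simp
  finally have "measure_pmf.prob (pair_pmf (random_subset S p) (random_subset T p))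
      {Z. R (fst Z) (snd Z)} \<le> b"
    using b0 by (simp add: measure_pmf.emeasure_eq_measure)
  then show ?thesis using prob_random_subset_split[OF assms(1-4), of p R] by simp
qed

lemma expectation_power_card_random_subset:
  assumes T: "finite T" and p: "0 \<le> p" "p \<le> 1" and a: "0 \<le> a"
  shows "measure_pmf.expectation (random_subset T p) (\<lambda>X. a ^ card X) = (1 + (a - 1) * p) ^ card T"
proof -
  have *: "a ^ card {e \<in> T. f e} = (\<Prod>e\<in>T. if f e then a else 1)" for f
    using T by (simp add: prod.If_cases Int_def)
  have "measure_pmf.expectation (random_subset T p) (\<lambda>X. a ^ card X) =
      measure_pmf.expectation (Pi_pmf T False (\<lambda>_. bernoulli_pmf p)) (\<lambda>f. \<Prod>e\<in>T. if f e then a else 1)"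
    unfolding random_subset_def integral_map_pmf * ..
  also have "\<dots> = (\<Prod>e\<in>T. measure_pmf.expectation (bernoulli_pmf p) (\<lambda>b. if b then a else 1))"
    by (rule expectation_prod_Pi_pmf[OF T]) (use a in \<open>auto intro: integrable_measure_pmf_finite\<close>)
  also have "\<dots> = (1 + (a - 1) * p) ^ card T" using p by (simp add: algebra_simps)
  finally show ?thesis .
qed

text \<open>Exponential Markov inequality. Through \<open>ev\<close> it serves both tails: upper
  tails take \<open>a\<close> at least 1, lower tails take \<open>a\<close> below 1.\<close>

lemma prob_card_random_subset_le:
  assumes T: "finite T" and p: "0 \<le> p" "p \<le> 1" and a: "0 < a"
    and ev: "\<And>X. X \<subseteq> T \<Longrightarrow> P X \<Longrightarrow> a powr m \<le> a powr real (card X)"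
  shows "measure_pmf.prob (random_subset T p) {X. P X} \<le> a powr (- m) * exp ((a - 1) * p * real (card T))"
proof -
  let ?M = "measure_pmf (random_subset T p)"
  have int: "integrable ?M (\<lambda>X. a ^ card X)"
    using T by (intro integrable_measure_pmf_finite)
      (auto intro: finite_subset[of _ "Pow T"] dest: random_subset_subset)
  have "measure_pmf.prob (random_subset T p) {X. P X} \<le>
      measure_pmf.prob (random_subset T p) {X \<in> space ?M. a powr m \<le> a ^ card X}"
    by (rule measure_pmf.finite_measure_mono_AE)
       (use ev a in \<open>auto simp: AE_measure_pmf_iff powr_realpow dest: random_subset_subset\<close>)
  also have "\<dots> \<le> measure_pmf.expectation (random_subset T p) (\<lambda>X. a ^ card X) / a powr m"
    using a by (intro integral_Markov_inequality_measure[where A = "{}"] int) auto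
  also have "\<dots> = a powr (- m) * (1 + (a - 1) * p) ^ card T"
    using expectation_power_card_random_subset[OF T p, of a] a by (simp add: powr_minus field_simps)
  also have "\<dots> \<le> a powr (- m) * exp ((a - 1) * p * real (card T))"
  proof (intro mult_left_mono)
    have "(1 + (a - 1) * p) ^ card T \<le> exp ((a - 1) * p) ^ card T"
    proof (rule power_mono)
      show "1 + (a - 1) * p \<le> exp ((a - 1) * p)" by (rule exp_ge_add_one_self)
      have "1 + (a - 1) * p = a * p + (1 - p)" by (simp add: algebra_simps)
      also have "\<dots> \<ge> 0" using a p by simp
      finally show "0 \<le> 1 + (a - 1) * p" .
    qed
    then show "(1 + (a - 1) * p) ^ card T \<le> exp ((a - 1) * p * real (card T))"
      by (simp add: exp_of_nat_mult[symmetric] mult_ac)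
  qed simp
  finally show ?thesis .
qed

lemma prob_random_subset_avoid:
  assumes T: "finite T" and p: "0 \<le> p" "p \<le> 1"
  shows "measure_pmf.prob (random_subset T p) {X. X = {}} = (1 - p) ^ card T"
proof -
  have "{f. {e \<in> T. f e} = {}} = Pi T (\<lambda>_. {False})" by (auto simp: Pi_def)
  then have "measure_pmf.prob (random_subset T p) {X. X = {}} =
      measure_pmf.prob (Pi_pmf T False (\<lambda>_. bernoulli_pmf p)) (Pi T (\<lambda>_. {False}))"
    by (simp add: random_subset_def vimage_def)
  also have "\<dots> = (1 - p) ^ card T"
    using p by (subst measure_Pi_pmf_Pi[OF T]) (simp add: measure_pmf_single)
  finally show ?thesis .
qed

lemma prob_random_subset_singleton:
  assumes p: "0 \<le> p" "p \<le> 1"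
  shows "measure_pmf.prob (random_subset {e} p) {X. e \<in> X} = p"
proof -
  have "{b. b} = {True}" by auto
  then show ?thesis
    using p by (simp add: random_subset_def vimage_def Pi_pmf_singleton measure_pmf_single)
qed

section \<open>Domination and escape in the binomial random graph\<close>

lemma prob_bex_le:
  assumes "finite A" "\<And>a. a \<in> A \<Longrightarrow> measure_pmf.prob M {x. P a x} \<le> b"
  shows "measure_pmf.prob M {x. \<exists>a\<in>A. P a x} \<le> real (card A) * b"
proof -
  have "measure_pmf.prob M (\<Union>a\<in>A. {x. P a x}) \<le> (\<Sum>a\<in>A. measure_pmf.prob M {x. P a x})"
    by (rule measure_pmf.finite_measure_subadditive_finite) (use assms in auto)
  also have "\<dots> \<le> real (card A) * b" by (rule sum_bounded_above) (use assms in auto)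
  also have "(\<Union>a\<in>A. {x. P a x}) = {x. \<exists>a\<in>A. P a x}" by auto
  finally show ?thesis .
qed

text \<open>Disjoint blocks carry independent information; in the induction the remaining blocks are
  merged into one part that is disjoint from \<open>B w\<close>.\<close>

lemma prob_random_subset_Ball:
  assumes fin: "finite A" "finite U" and B: "\<And>u. u \<in> U \<Longrightarrow> B u \<subseteq> A"
    and disj: "\<And>u u'. u \<in> U \<Longrightarrow> u' \<in> U \<Longrightarrow> u \<noteq> u' \<Longrightarrow> B u \<inter> B u' = {}"
  shows "measure_pmf.prob (random_subset A p) {X. \<forall>u\<in>U. P u (X \<inter> B u)} =
    (\<Prod>u\<in>U. measure_pmf.prob (random_subset A p) {X. P u (X \<inter> B u)})"
  using fin(2) B disj
proof (induction U rule: finite_induct)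
  case empty then show ?case by simp
next
  case (insert w U)
  have *: "X \<inter> (\<Union>v\<in>U. B v) \<inter> B u = X \<inter> B u" if "u \<in> U" for X u using that by auto
  have "measure_pmf.prob (random_subset A p) {X. \<forall>u\<in>insert w U. P u (X \<inter> B u)} =
      measure_pmf.prob (random_subset A p)
        {X. P w (X \<inter> B w) \<and> (\<forall>u\<in>U. P u (X \<inter> (\<Union>v\<in>U. B v) \<inter> B u))}"
    using * by (intro arg_cong2[where f = measure]) auto
  also have "\<dots> = measure_pmf.prob (random_subset A p) {X. P w (X \<inter> B w)} *
      measure_pmf.prob (random_subset A p) {X. \<forall>u\<in>U. P u (X \<inter> (\<Union>v\<in>U. B v) \<inter> B u)}"
    by (rule prob_random_subset_indep[OF fin(1), where Q = "\<lambda>Y. \<forall>u\<in>U. P u (Y \<inter> B u)"])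
       (use insert.prems insert.hyps(2) in \<open>auto, blast\<close>)
  also have "{X. \<forall>u\<in>U. P u (X \<inter> (\<Union>v\<in>U. B v) \<inter> B u)} = {X. \<forall>u\<in>U. P u (X \<inter> B u)}"
    using * by auto
  finally show ?case using insert by simp
qed

section \<open>Edge sets of the random graph\<close>

lemma finite_vertex_pairs: "finite (vertex_pairs n)"
  by (rule finite_subset[of _ "Pow {1..n}"]) (auto simp: vertex_pairs_def)

lemma gnp_subset: "E \<in> set_pmf (gnp n p) \<Longrightarrow> E \<subseteq> vertex_pairs n"
  unfolding gnp_random_subset by (rule random_subset_subset)

lemma vertex_pairs_Union: "E \<subseteq> vertex_pairs n \<Longrightarrow> \<Union>E \<subseteq> {1..n}"
  by (auto simp: vertex_pairs_def)

lemma vertex_pairs_loopless: "E \<subseteq> vertex_pairs n \<Longrightarrow> {v} \<notin> E"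
  by (auto simp: vertex_pairs_def)

lemma doubleton_in_vertex_pairs: "{u, v} \<in> vertex_pairs n \<longleftrightarrow> u \<in> {1..n} \<and> v \<in> {1..n} \<and> u \<noteq> v"
  by (auto simp: vertex_pairs_def card_2_iff doubleton_eq_iff)

text \<open>Possible edges, present or not: a degree into \<open>S\<close> becomes the size of the
  intersection of the random edge set with a fixed set.\<close>

definition star :: "'v \<Rightarrow> 'v set \<Rightarrow> 'v set set" where
  "star v S = (\<lambda>u. {v, u}) ` S"

lemma star_subset: "v \<in> {1..n} \<Longrightarrow> S \<subseteq> {1..n} - {v} \<Longrightarrow> star v S \<subseteq> vertex_pairs n"
  using doubleton_in_vertex_pairs by (fastforce simp: star_def)

lemma card_star: "card (star v S) = card S"
  unfolding star_def by (rule card_image) (auto simp: inj_on_def doubleton_eq_iff)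

lemma card_nbrs_Int: "card (nbrs E v \<inter> S) = card (E \<inter> star v S)"
proof -
  have "E \<inter> star v S = star v (nbrs E v \<inter> S)" by (auto simp: star_def nbrs_def)
  then show ?thesis by (simp add: card_star)
qed

lemma prob_gnp_avoid:
  assumes p: "0 \<le> p" "p \<le> 1" and T: "T \<subseteq> vertex_pairs n"
  shows "measure_pmf.prob (gnp n p) {E. E \<inter> T = {}} = (1 - p) ^ card T"
proof -
  have "finite T" using T finite_vertex_pairs by (rule finite_subset)
  then show ?thesis unfolding gnp_random_subset
    using prob_random_subset_restrict[OF finite_vertex_pairs T, of p "\<lambda>X. X = {}"]
      prob_random_subset_avoid[OF _ p] by simp
qed

text \<open>The cops take the fixed set {1..k}; each outside vertex is undominated with probability
  \<open>(1 - p) ^ k\<close>, and there are at most \<open>n\<close> of them.\<close>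

lemma prob_not_dominated_le:
  assumes p: "0 \<le> p" "p \<le> 1" and k: "k \<le> n"
  shows "measure_pmf.prob (gnp n p) {E. \<not> lazy_cops_win {1..n} E k} \<le> real n * (1 - p) ^ k"
proof -
  have win: "lazy_cops_win {1..n} E k" if dom: "\<forall>v\<in>{1..n} - {1..k}. E \<inter> star v {1..k} \<noteq> {}" for E
  proof (rule lazy_cops_win_if_dominating[where c = Suc])
    fix v assume v: "v \<in> {1..n}"
    show "\<exists>i<k. Suc i = v \<or> {Suc i, v} \<in> E"
    proof (cases "v \<le> k")
      case True then show ?thesis using v by (intro exI[of _ "v - 1"]) auto
    next
      case False
      then obtain u where "u \<in> {1..k}" "{v, u} \<in> E" using dom v by (fastforce simp: star_def)
      then show ?thesis by (intro exI[of _ "u - 1"]) (auto simp: insert_commute)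
    qed
  qed (use k in auto)
  have "measure_pmf.prob (gnp n p) {E. \<not> lazy_cops_win {1..n} E k} \<le>
      measure_pmf.prob (gnp n p) {E. \<exists>v\<in>{1..n} - {1..k}. E \<inter> star v {1..k} = {}}"
    by (rule measure_pmf.finite_measure_mono) (use win in auto)
  also have "\<dots> \<le> real (card ({1..n} - {1..k})) * (1 - p) ^ k"
  proof (rule prob_bex_le)
    fix v assume "v \<in> {1..n} - {1..k}"
    then have "star v {1..k} \<subseteq> vertex_pairs n" using k by (intro star_subset) auto
    then show "measure_pmf.prob (gnp n p) {E. E \<inter> star v {1..k} = {}} \<le> (1 - p) ^ k"
      using prob_gnp_avoid[OF p, of "star v {1..k}" n] by (simp add: card_star)
  qed simp
  also have "\<dots> \<le> real n * (1 - p) ^ k"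
    using p card_mono[of "{1..n}" "{1..n} - {1..k}"] by (intro mult_right_mono) auto
  finally show ?thesis .
qed

definition escapable :: "'v set \<Rightarrow> 'v set set \<Rightarrow> 'v set \<Rightarrow> 'v \<Rightarrow> bool" where
  "escapable V E S v \<longleftrightarrow> (\<exists>u\<in>V - S - {v}. {u, v} \<in> E \<and> E \<inter> star u S = {})"

lemma robber_wins_escapable:
  assumes fin: "finite V" and edges: "\<Union>E \<subseteq> V" and k: "k < card V" "k' \<le> k"
    and esc: "\<And>S v. S \<subseteq> V \<Longrightarrow> card S = k \<Longrightarrow> v \<in> V - S \<Longrightarrow> escapable V E S v"
  shows "\<not> lazy_cops_win V E k'"
proof -
  have free: "\<exists>u\<in>V. {v, u} \<in> E \<and> (\<forall>i<k'. c i \<noteq> u \<and> {u, c i} \<notin> E)"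
    if v: "v \<in> V" and c: "\<forall>i<k'. c i \<in> V \<and> c i \<noteq> v" for v c
  proof -
    have "card (c ` {..<k'}) \<le> k" using card_image_le[of "{..<k'}" c] k by simp
    moreover have "k \<le> card (V - {v})" using k fin v by simp
    moreover have "c ` {..<k'} \<subseteq> V - {v}" using c by auto
    ultimately obtain S where S: "c ` {..<k'} \<subseteq> S" "S \<subseteq> V - {v}" "card S = k"
      using exists_subset_between[of "c ` {..<k'}" k "V - {v}"] fin by auto
    then have "escapable V E S v" using v by (intro esc) auto
    then obtain u where u: "u \<in> V - S - {v}" "{u, v} \<in> E" "E \<inter> star u S = {}"
      unfolding escapable_def by blast
    then have "\<forall>i<k'. c i \<noteq> u \<and> {u, c i} \<notin> E" using S(1) by (auto simp: star_def)
    then show ?thesis using u by (auto simp: insert_commute)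
  qed
  show ?thesis
  proof (rule robber_escapes[OF edges, where I = "\<lambda>v c. \<forall>i<k'. c i \<noteq> v \<and> {v, c i} \<notin> E"])
    fix c assume c: "\<forall>i<k'. c i \<in> V"
    \<comment> \<open>The starting vertex is found as an escape from some unoccupied vertex.\<close>
    have "card (c ` {..<k'}) < card V" using card_image_le[of "{..<k'}" c] k by simp
    then obtain v where "v \<in> V" "\<forall>i<k'. c i \<noteq> v"
      by (metis card_mono finite_imageI finite_lessThan imageI lessThan_iff linorder_not_less subsetI)
    then show "\<exists>v\<in>V. \<forall>i<k'. c i \<noteq> v \<and> {v, c i} \<notin> E" using free[of v c] c by blast
  next
    fix v c c'
    assume I: "\<forall>i<k'. c i \<noteq> v \<and> {v, c i} \<notin> E" and v: "v \<in> V" and c': "\<forall>i<k'. c' i \<in> V"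
      and move: "lazy_move E k' c c'"
    have "\<forall>i<k'. c' i \<noteq> v"
      using move I unfolding lazy_move_def by (metis insert_commute)
    then show "(\<forall>i<k'. c' i \<noteq> v) \<and>
        (\<exists>u\<in>V. (u = v \<or> {v, u} \<in> E) \<and> (\<forall>i<k'. c' i \<noteq> u \<and> {u, c' i} \<notin> E))"
      using free[OF v, of c'] c' by blast
  qed blast
qed

text \<open>Whether \<open>u\<close> serves as an escape depends only on the pairs in
  \<open>star u (insert v S)\<close>. These blocks are disjoint for different \<open>u\<close>, so
  the failures are independent, each of probability 1 - q.\<close>

lemma prob_not_escapable_le:
  assumes p: "0 \<le> p" "p \<le> 1" and S: "S \<subseteq> {1..n}" and v: "v \<in> {1..n} - S"
  shows "measure_pmf.prob (gnp n p) {E. \<not> escapable {1..n} E S v} \<le>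
    exp (- (p * (1 - p) ^ card S * (real n - real (card S) - 1)))"
proof -
  define U where "U = {1..n} - S - {v}"
  define q where "q = p * (1 - p) ^ card S"
  define bad where "bad u X \<longleftrightarrow> \<not> ({u, v} \<in> X \<and> X \<inter> star u S = {})" for u X
  have blk: "star u (insert v S) \<subseteq> vertex_pairs n" if "u \<in> U" for u
    using that S v by (intro star_subset) (auto simp: U_def)
  have bad_eq: "bad u X \<longleftrightarrow> bad u (X \<inter> star u (insert v S))" for u X
    by (auto simp: bad_def star_def)
  have one: "measure_pmf.prob (gnp n p) {X. bad u (X \<inter> star u (insert v S))} = 1 - q" if u: "u \<in> U" for u
  proof -
    have "measure_pmf.prob (gnp n p) {X. {u, v} \<in> X \<and> X \<inter> star u S = {}} =
        measure_pmf.prob (gnp n p) {X. {u, v} \<in> X \<inter> {{u, v}} \<and> X \<inter> star u S = {}}" by simp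
    also have "\<dots> = measure_pmf.prob (gnp n p) {X. {u, v} \<in> X \<inter> {{u, v}}} *
        measure_pmf.prob (gnp n p) {X. X \<inter> star u S = {}}"
      unfolding gnp_random_subset
      by (rule prob_random_subset_indep[OF finite_vertex_pairs, where Q = "\<lambda>X. X = {}"])
         (use blk[OF u] v in \<open>auto simp: star_def doubleton_eq_iff\<close>)
    also have "measure_pmf.prob (gnp n p) {X. {u, v} \<in> X \<inter> {{u, v}}} = p"
      unfolding gnp_random_subset
      using prob_random_subset_restrict[OF finite_vertex_pairs, of "{{u, v}}" n p "\<lambda>X. {u, v} \<in> X"]
        prob_random_subset_singleton[OF p, of "{u, v}"] blk[OF u] by (simp add: star_def)
    also have "measure_pmf.prob (gnp n p) {X. X \<inter> star u S = {}} = (1 - p) ^ card S"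
      using prob_gnp_avoid[OF p, of "star u S" n] blk[OF u] by (simp add: star_def card_star[unfolded star_def])
    finally have "measure_pmf.prob (gnp n p) {X. \<not> bad u X} = q" by (simp add: bad_def q_def)
    moreover have "{X. bad u X} = space (measure_pmf (gnp n p)) - {X. \<not> bad u X}" by auto
    ultimately show ?thesis
      using measure_pmf.prob_compl[of "{X. \<not> bad u X}" "gnp n p"] by (simp flip: bad_eq)
  qed
  have q1: "q \<le> 1" unfolding q_def using p by (simp add: mult_le_one power_le_one)
  have "{E. \<not> escapable {1..n} E S v} = {X. \<forall>u\<in>U. bad u (X \<inter> star u (insert v S))}"
    unfolding bad_eq[symmetric] by (auto simp: escapable_def bad_def U_def)
  then have "measure_pmf.prob (gnp n p) {E. \<not> escapable {1..n} E S v} =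
      (\<Prod>u\<in>U. measure_pmf.prob (gnp n p) {X. bad u (X \<inter> star u (insert v S))})"
    unfolding gnp_random_subset
    by (simp only:, intro prob_random_subset_Ball finite_vertex_pairs blk)
       (auto simp: U_def star_def doubleton_eq_iff)
  also have "\<dots> = (1 - q) ^ card U" using one by simp
  also have "\<dots> \<le> exp (- q) ^ card U"
    using q1 exp_ge_add_one_self[of "- q"] by (intro power_mono) auto
  also have "\<dots> = exp (- (q * real (card U)))" by (simp add: exp_of_nat_mult[symmetric] mult.commute)
  also have "real (card U) = real n - real (card S) - 1"
  proof -
    have "finite S" using S finite_subset by auto
    moreover have "card (insert v S) \<le> n" using card_mono[of "{1..n}" "insert v S"] S v by simp
    moreover have "U = {1..n} - insert v S" by (auto simp: U_def)
    ultimately show ?thesis using S v by (simp add: card_Diff_subset of_nat_diff)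
  qed
  finally show ?thesis by (simp add: q_def)
qed

lemma prob_dense_win_le:
  assumes p: "0 \<le> p" "p \<le> 1" and k: "k < n"
  shows "measure_pmf.prob (gnp n p) {E. \<exists>k'\<le>k. lazy_cops_win {1..n} E k'} \<le>
    real n ^ (k + 1) * exp (- (p * (1 - p) ^ k * (real n - real k - 1)))"
proof -
  define \<S> where "\<S> = {S. S \<subseteq> {1..n} \<and> card S = k}"
  let ?b = "exp (- (p * (1 - p) ^ k * (real n - real k - 1)))"
  have "measure_pmf.prob (gnp n p) {E. \<exists>k'\<le>k. lazy_cops_win {1..n} E k'} \<le>
      measure_pmf.prob (gnp n p) {E. \<exists>S\<in>\<S>. \<exists>v\<in>{1..n} - S. \<not> escapable {1..n} E S v}"
  proof (rule measure_pmf.finite_measure_mono_AE)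
    show "AE E in gnp n p. E \<in> {E. \<exists>k'\<le>k. lazy_cops_win {1..n} E k'} \<longrightarrow>
        E \<in> {E. \<exists>S\<in>\<S>. \<exists>v\<in>{1..n} - S. \<not> escapable {1..n} E S v}"
      unfolding AE_measure_pmf_iff
    proof (intro ballI impI, rule ccontr)
      fix E assume E: "E \<in> set_pmf (gnp n p)" "E \<in> {E. \<exists>k'\<le>k. lazy_cops_win {1..n} E k'}"
        "E \<notin> {E. \<exists>S\<in>\<S>. \<exists>v\<in>{1..n} - S. \<not> escapable {1..n} E S v}"
      then obtain k' where "k' \<le> k" "lazy_cops_win {1..n} E k'" by blast
      then show False
        using robber_wins_escapable[of "{1..n}" E k k'] E(3) k vertex_pairs_Union[OF gnp_subset[OF E(1)]]
        by (auto simp: \<S>_def)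
    qed
  qed auto
  also have "\<dots> \<le> real (card \<S>) * (real n * ?b)"
  proof (rule prob_bex_le)
    show "finite \<S>" by (rule finite_subset[of _ "Pow {1..n}"]) (auto simp: \<S>_def)
    fix S assume S: "S \<in> \<S>"
    have "measure_pmf.prob (gnp n p) {E. \<exists>v\<in>{1..n} - S. \<not> escapable {1..n} E S v} \<le>
        real (card ({1..n} - S)) * ?b"
      by (rule prob_bex_le) (use prob_not_escapable_le[OF p, of S n] S in \<open>auto simp: \<S>_def\<close>)
    also have "\<dots> \<le> real n * ?b"
      using card_mono[of "{1..n}" "{1..n} - S"] by (intro mult_right_mono) auto
    finally show "measure_pmf.prob (gnp n p) {E. \<exists>v\<in>{1..n} - S. \<not> escapable {1..n} E S v} \<le> real n * ?b" .
  qed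
  also have "\<dots> \<le> real n ^ k * (real n * ?b)"
  proof (rule mult_right_mono)
    have "card \<S> = n choose k" unfolding \<S>_def using n_subsets[of "{1..n}" k] by simp
    also have "\<dots> \<le> n ^ k" by (rule binomial_le_pow) (use k in simp)
    finally show "real (card \<S>) \<le> real n ^ k" by (metis of_nat_le_iff of_nat_power)
  qed simp
  finally show ?thesis by (simp add: mult_ac)
qed

section \<open>Sparse random graphs\<close>

lemma prob_gnp_card_star_le:
  assumes p: "0 \<le> p" "p \<le> 1" and T: "T \<subseteq> vertex_pairs n" and a: "0 < a"
    and ev: "\<And>m. P m \<Longrightarrow> a powr x \<le> a powr real m"
  shows "measure_pmf.prob (gnp n p) {E. P (card (E \<inter> T))} \<le>
    a powr (- x) * exp ((a - 1) * p * real (card T))"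
  unfolding gnp_random_subset
    prob_random_subset_restrict[OF finite_vertex_pairs T, where P = "\<lambda>X. P (card X)"]
  by (rule prob_card_random_subset_le[OF finite_subset[OF T finite_vertex_pairs] p a]) (rule ev)

lemma prob_degree_gt_le:
  assumes p: "0 \<le> p" "p \<le> 1" and v: "v \<in> {1..n}"
  shows "measure_pmf.prob (gnp n p) {E. 4 * (real n * p) < real (card (nbrs E v \<inter> ({1..n} - {v})))}
    \<le> exp (- (real n * p / 8))"
proof -
  let ?T = "star v ({1..n} - {v})"
  let ?e = "exp 1 :: real"
  have T: "?T \<subseteq> vertex_pairs n" using v by (intro star_subset) auto
  \<comment> \<open>Base e: since e - 1 \<le> 2, the exponent is at most - 4 n p + 2 n p.\<close>
  have "measure_pmf.prob (gnp n p) {E. 4 * (real n * p) < real (card (E \<inter> ?T))} \<le>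
      ?e powr (- (4 * (real n * p))) * exp ((?e - 1) * p * real (card ?T))"
    by (rule prob_gnp_card_star_le[OF p T]) (auto intro!: powr_mono)
  also have "\<dots> = exp (- (4 * (real n * p)) + (?e - 1) * p * (real n - 1))"
    using v by (simp add: card_star powr_def exp_add[symmetric] of_nat_diff algebra_simps)
  also have "\<dots> \<le> exp (- (real n * p / 8))"
  proof -
    have "(?e - 1) * (p * (real n - 1)) \<le> 2 * (p * real n)"
      using e_less_272 p v by (intro mult_mono) (auto intro: mult_left_mono)
    moreover have "0 \<le> p * real n" using p by simp
    ultimately show ?thesis by (simp add: algebra_simps)
  qed
  finally show ?thesis by (simp only: card_nbrs_Int)
qed

lemma prob_degree_lt_le:
  assumes p: "0 \<le> p" "p \<le> 1" and n: "2 \<le> n" and v: "v \<in> {1..n}"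
  shows "measure_pmf.prob (gnp n p) {E. real (card (nbrs E v \<inter> ({1..n} - {v}))) < real n * p / 8}
    \<le> exp (- (real n * p / 8))"
proof -
  let ?T = "star v ({1..n} - {v})"
  have T: "?T \<subseteq> vertex_pairs n" using v by (intro star_subset) auto
  \<comment> \<open>Base 1/2: by ln 2 \<le> 1 and n - 1 \<ge> n / 2, the exponent is at most n p / 8
    - n p / 4.\<close>
  have "measure_pmf.prob (gnp n p) {E. real (card (E \<inter> ?T)) < real n * p / 8} \<le>
      (1 / 2) powr (- (real n * p / 8)) * exp ((1 / 2 - 1) * p * real (card ?T))"
    by (rule prob_gnp_card_star_le[OF p T]) (auto intro!: powr_mono')
  also have "\<dots> = exp (ln 2 * (real n * p / 8) - p * (real n - 1) / 2)"
    using v n by (simp add: card_star powr_def exp_add[symmetric] of_nat_diff ln_div algebra_simps)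
  also have "\<dots> \<le> exp (- (real n * p / 8))"
  proof -
    have "p * (real n / 2) \<le> p * (real n - 1)" using p n by (intro mult_left_mono) auto
    moreover have "ln 2 * (real n * p / 8) \<le> 1 * (real n * p / 8)"
      using p ln_2_less_1 by (intro mult_right_mono) auto
    ultimately show ?thesis by (simp add: algebra_simps)
  qed
  finally show ?thesis by (simp only: card_nbrs_Int)
qed

text \<open>The ball around \<open>c\<close> in the graph without \<open>v\<close> is independent of the edges at \<open>v\<close>.\<close>

lemma prob_nbrs_gball_gt_le:
  assumes p: "0 \<le> p" "p \<le> 1" and vc: "v \<in> {1..n}" "c \<in> {1..n}" "v \<noteq> c" and a: "1 \<le> a" and N: "0 \<le> N"
  shows "measure_pmf.prob (gnp n p) {E. real (card (gball (del_vertex v E) l c)) \<le> N \<and>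
      K < real (card (nbrs E v \<inter> gball (del_vertex v E) l c))}
    \<le> a powr (- K) * exp (a * (N * p))"
proof -
  \<comment> \<open>\<open>R\<close> reads the ball off the pairs in \<open>T\<close>, which avoid
    \<open>v\<close>. Once that part is fixed, the ball is a fixed set; it has at most
    \<open>N\<close> elements, or the event is empty.\<close>
  define S where "S = {e \<in> vertex_pairs n. v \<in> e}"
  define T where "T = {e \<in> vertex_pairs n. v \<notin> e}"
  define R where "R X Y \<longleftrightarrow> real (card (gball Y l c)) \<le> N \<and> K < real (card (X \<inter> star v (gball Y l c)))" for X Y
  have ST: "S \<subseteq> vertex_pairs n" "T \<subseteq> vertex_pairs n" "S \<inter> T = {}" by (auto simp: S_def T_def)
  have "measure_pmf.prob (gnp n p) {E. real (card (gball (del_vertex v E) l c)) \<le> N \<and>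
      K < real (card (nbrs E v \<inter> gball (del_vertex v E) l c))} \<le>
      measure_pmf.prob (gnp n p) {E. R (E \<inter> S) (E \<inter> T)}"
  proof (rule measure_pmf.finite_measure_mono_AE)
    have "R (E \<inter> S) (E \<inter> T)" if E: "E \<in> set_pmf (gnp n p)"
      and "real (card (gball (del_vertex v E) l c)) \<le> N"
        "K < real (card (nbrs E v \<inter> gball (del_vertex v E) l c))" for E
    proof -
      have 1: "del_vertex v E = E \<inter> T" using gnp_subset[OF E] by (auto simp: del_vertex_def T_def)
      have "E \<inter> star v B = E \<inter> S \<inter> star v B" for B
        using gnp_subset[OF E] by (auto simp: star_def S_def)
      then show ?thesis using that(2,3) unfolding R_def card_nbrs_Int 1 by metis
    qed
    then show "AE E in gnp n p. E \<in> {E. real (card (gball (del_vertex v E) l c)) \<le> N \<and>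
      K < real (card (nbrs E v \<inter> gball (del_vertex v E) l c))} \<longrightarrow> E \<in> {E. R (E \<inter> S) (E \<inter> T)}"
      by (simp add: AE_measure_pmf_iff)
  qed auto
  also have "\<dots> \<le> a powr (- K) * exp (a * (N * p))"
    unfolding gnp_random_subset
  proof (rule prob_random_subset_condition[OF finite_vertex_pairs ST])
    fix Y assume Y: "Y \<subseteq> T"
    let ?B = "gball Y l c"
    have B: "?B \<subseteq> {1..n} - {v}"
      using vc Y by (intro gball_subset) (auto simp: T_def vertex_pairs_def)
    have star: "star v ?B \<subseteq> vertex_pairs n" using vc B by (intro star_subset) auto
    then have sub: "star v ?B \<subseteq> S" by (auto simp: S_def star_def)
    have finS: "finite S" using ST(1) finite_vertex_pairs by (rule finite_subset)
    show "measure_pmf.prob (random_subset S p) {X. R X Y} \<le> a powr (- K) * exp (a * (N * p))"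
    proof (cases "real (card ?B) \<le> N")
      case True
      have "measure_pmf.prob (random_subset S p) {X. R X Y} =
          measure_pmf.prob (random_subset (star v ?B) p) {X. K < real (card X)}"
        using True prob_random_subset_restrict[OF finS sub, of p "\<lambda>X. K < real (card X)"]
        by (simp add: R_def)
      also have "\<dots> \<le> a powr (- K) * exp ((a - 1) * p * real (card (star v ?B)))"
        by (rule prob_card_random_subset_le[OF finite_subset[OF sub finS] p])
           (use a in \<open>auto intro!: powr_mono\<close>)
      also have "\<dots> \<le> a powr (- K) * exp (a * (N * p))"
      proof -
        have "(a - 1) * (p * real (card (star v ?B))) \<le> a * (p * N)"
          using True a p by (intro mult_mono) (auto simp: card_star intro: mult_left_mono)
        then show ?thesis by (intro mult_left_mono) (auto simp: mult_ac)
      qed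
      finally show ?thesis .
    next
      case False
      then show ?thesis by (simp add: R_def)
    qed
  qed
  finally show ?thesis .
qed

text \<open>What the potential argument asks of a graph; \<open>d\<close> will be n p. Ball sizes
  follow from the maximum degree.\<close>

definition sparse_good :: "nat \<Rightarrow> real \<Rightarrow> nat \<Rightarrow> (nat \<Rightarrow> real) \<Rightarrow> nat set set \<Rightarrow> bool" where
  "sparse_good n d J K E \<longleftrightarrow> E \<subseteq> vertex_pairs n \<and>
    (\<forall>v\<in>{1..n}. d / 8 \<le> real (card (nbrs E v)) \<and> real (card (nbrs E v)) \<le> 4 * d) \<and>
    (\<forall>l\<in>{..J}. \<forall>v\<in>{1..n}. \<forall>c\<in>{1..n} - {v}.
      real (card (nbrs E v \<inter> gball (del_vertex v E) l c)) \<le> K l)"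

text \<open>The weights are chosen to make the contraction condition an equality, 8 a_l K_l = (d /
  8) a_(l+1); decay then reads 512 K_l \<le> d. Since \<open>a l * (8 * d) ^ l\<close> is the
  product of the 512 K_i with i < l, the weights vanish from the hypotheses: \<open>k1\<close>
  provides the start, and \<open>k2\<close> says that k a_J K_J \<le> 4.\<close>

lemma robber_wins_sparse:
  fixes K :: "nat \<Rightarrow> real"
  assumes good: "sparse_good n d J K E" and n: "1 \<le> n" and d: "1 \<le> d" and J: "1 \<le> J"
    and K1: "\<And>l. 1 \<le> K l" and Kd: "\<And>l. l < J \<Longrightarrow> 512 * K l \<le> d"
    and k1: "real k * d * (real J + 1) * (\<Prod>l<J. 512 * K l) < 64 * real n"
    and k2: "real k * (\<Prod>l<J. 512 * K l) * K J \<le> 4 * (8 * d) ^ J"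
  shows "\<not> lazy_cops_win {1..n} E k"
proof -
  define a where "a l = (\<Prod>i<l. 64 * K i / d)" for l
  define P where "P = (\<Prod>l<J. 512 * K l)"
  have d0: "0 < d" using d by simp
  have K0: "0 \<le> K l" for l using K1[of l] by linarith
  have a0: "0 \<le> a l" for l unfolding a_def using K0 d by (intro prod_nonneg) simp
  have aS: "a (Suc l) = a l * (64 * K l / d)" for l by (simp add: a_def)
  have a1: "a 1 = 64 * K 0 / d" by (simp add: a_def)
  have a8: "a l * (8 * d) ^ l = (\<Prod>i<l. 512 * K i)" for l
  proof -
    have "a l * (8 * d) ^ l = (\<Prod>i<l. 64 * K i / d * (8 * d))"
      unfolding a_def prod.distrib[of "\<lambda>i. 64 * K i / d" "\<lambda>_. 8 * d"] by simp
    also have "\<dots> = (\<Prod>i<l. 512 * K i)" using d by (intro prod.cong) auto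
    finally show ?thesis .
  qed
  have Pl: "(\<Prod>i<l. 512 * K i) \<le> P" if "l \<le> J" for l
    unfolding P_def
  proof (rule prod_mono2)
    show "1 \<le> 512 * K b" for b using K1[of b] by linarith
    show "0 \<le> 512 * K b" for b using K0[of b] by simp
  qed (use that in auto)
  have E: "E \<subseteq> vertex_pairs n"
    and deg: "\<And>v. v \<in> {1..n} \<Longrightarrow> d / 8 \<le> real (card (nbrs E v)) \<and> real (card (nbrs E v)) \<le> 4 * d"
    and cnt: "\<And>l v c. l \<le> J \<Longrightarrow> v \<in> {1..n} \<Longrightarrow> c \<in> {1..n} \<Longrightarrow> v \<noteq> c \<Longrightarrow>
      real (card (nbrs E v \<inter> gball (del_vertex v E) l c)) \<le> K l"
    using good unfolding sparse_good_def by auto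
  show ?thesis
  proof (rule robber_wins_layers[where D = "d / 8" and \<Delta> = "4 * d" and a = a and K = K and J = J])
    show "8 * a (Suc l) \<le> a l" if "l < J" for l
    proof -
      have "a l * (512 * K l / d) \<le> a l * 1"
        using Kd[OF that] d a0 by (intro mult_left_mono) auto
      moreover have "8 * a (Suc l) = a l * (512 * K l / d)" by (simp add: aS)
      ultimately show ?thesis by linarith
    qed
    show "8 * a l * K l \<le> d / 8 * a (Suc l)" for l using d0 by (simp add: aS)
    show "2 * real k * (a J * K J) \<le> d / 8 * a 1"
    proof -
      have "real k * (a J * (8 * d) ^ J) * K J \<le> 4 * (8 * d) ^ J" using k2 a8[of J] by simp
      then have "(8 * d) ^ J * (real k * (a J * K J)) \<le> (8 * d) ^ J * 4" by (simp add: mult_ac)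
      moreover have "0 < (8 * d) ^ J" using d by simp
      ultimately have "real k * (a J * K J) \<le> 4" by (rule mult_left_le_imp_le)
      \<comment> \<open>By K 0 \<ge> 1 this is at least 8 = 2 * 4, which explains the constant 4 in
        \<open>k2\<close>.\<close>
      moreover have "d / 8 * a 1 = 8 * K 0" using d0 by (simp add: a1[unfolded One_nat_def])
      ultimately show ?thesis using K1[of 0] by linarith
    qed
    show "real k * (\<Sum>l\<le>J. a l * (1 + 4 * d) ^ l) < real (card {1..n}) * a 1"
    proof -
      have "(\<Sum>l\<le>J. a l * (1 + 4 * d) ^ l) \<le> (\<Sum>l\<le>J. P)"
      proof (rule sum_mono)
        fix l assume "l \<in> {..J}"
        have "a l * (1 + 4 * d) ^ l \<le> a l * (8 * d) ^ l"
          using d a0 by (intro mult_left_mono power_mono) auto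
        also have "\<dots> \<le> P" unfolding a8 using Pl \<open>l \<in> {..J}\<close> by simp
        finally show "a l * (1 + 4 * d) ^ l \<le> P" .
      qed
      then have "real k * (\<Sum>l\<le>J. a l * (1 + 4 * d) ^ l) \<le> real k * ((1 + real J) * P)"
        by (intro mult_left_mono) auto
      also have "\<dots> < 64 * real n / d" using k1 d0 by (simp add: P_def pos_less_divide_eq mult_ac add.commute)
      also have "\<dots> \<le> real n * a 1"
      proof -
        have "real n * 64 * 1 \<le> real n * 64 * K 0" using K1[of 0] by (intro mult_left_mono) auto
        then show ?thesis using d0 by (simp add: a1[unfolded One_nat_def] field_simps)
      qed
      finally show ?thesis by simp
    qed
  qed (use d a0 K0 J deg cnt n vertex_pairs_Union[OF E] vertex_pairs_loopless[OF E] in auto)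
qed

text \<open>\<open>a l\<close> is the base of the exponential Markov inequality, free for each
  radius. The tail 1 / n^3 beats the n^2 pairs (v, c), leaving (J + 1) / n; the two degree
  conditions give the exponential term.\<close>

lemma prob_not_sparse_good_le:
  fixes K a :: "nat \<Rightarrow> real"
  assumes p: "0 \<le> p" "p \<le> 1" and n: "2 \<le> n" and d: "d = real n * p" "1 \<le> d"
    and a: "\<And>l. l \<le> J \<Longrightarrow> 1 \<le> a l"
    and tail: "\<And>l. l \<le> J \<Longrightarrow> a l powr (- K l) * exp (a l * ((8 * d) ^ l * p)) \<le> 1 / real n ^ 3"
  shows "measure_pmf.prob (gnp n p) {E. \<not> sparse_good n d J K E} \<le>
    2 * real n * exp (- d / 8) + (real J + 1) / real n"
proof -
  let ?V = "{1..n}"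
  define B1 where "B1 = {E. \<exists>v\<in>?V. 4 * d < real (card (nbrs E v \<inter> (?V - {v})))}"
  define B2 where "B2 = {E. \<exists>v\<in>?V. real (card (nbrs E v \<inter> (?V - {v}))) < d / 8}"
  define B3 where "B3 = {E. \<exists>l\<in>{..J}. \<exists>v\<in>?V. \<exists>c\<in>?V - {v}.
      real (card (gball (del_vertex v E) l c)) \<le> (8 * d) ^ l \<and>
      K l < real (card (nbrs E v \<inter> gball (del_vertex v E) l c))}"
  have n0: "0 < real n" using n by simp
  have "measure_pmf.prob (gnp n p) {E. \<not> sparse_good n d J K E} \<le> measure_pmf.prob (gnp n p) (B1 \<union> B2 \<union> B3)"
  proof (rule measure_pmf.finite_measure_mono_AE)
    have "sparse_good n d J K E" if E: "E \<in> set_pmf (gnp n p)" and B: "E \<notin> B1 \<union> B2 \<union> B3" for E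
    proof -
      note EV = gnp_subset[OF E]
      have nb: "nbrs E v \<inter> (?V - {v}) = nbrs E v" for v
        using nbrs_subset[OF vertex_pairs_Union[OF EV], of v] vertex_pairs_loopless[OF EV, of v]
        by (auto simp: nbrs_def)
      have deg: "d / 8 \<le> real (card (nbrs E v)) \<and> real (card (nbrs E v)) \<le> 4 * d" if "v \<in> ?V" for v
      proof -
        have "E \<notin> B1" "E \<notin> B2" using B by blast+
        then have "\<not> 4 * d < real (card (nbrs E v \<inter> (?V - {v})))"
          "\<not> real (card (nbrs E v \<inter> (?V - {v}))) < d / 8"
          using that unfolding B1_def B2_def by blast+
        then show ?thesis unfolding nb by simp
      qed
      have ball: "real (card (gball (del_vertex v E) l c)) \<le> (8 * d) ^ l" if "c \<in> ?V" for v l c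
      proof -
        have del: "del_vertex v E \<subseteq> E" by (auto simp: del_vertex_def)
        have sub: "\<Union>(del_vertex v E) \<subseteq> ?V"
          using vertex_pairs_Union[OF EV] del by blast
        have "card (nbrs (del_vertex v E) w) \<le> card (nbrs E w)" for w
          using del finite_subset[OF nbrs_subset[OF vertex_pairs_Union[OF EV]]]
          by (intro card_mono) (auto simp: nbrs_def)
        then have "real (card (nbrs (del_vertex v E) w)) \<le> 4 * d" if "w \<in> ?V" for w
          using deg[OF that] by (meson of_nat_le_iff order_trans)
        then have "real (card (gball (del_vertex v E) l c)) \<le> (1 + 4 * d) ^ l"
          using that by (intro card_gball_le[OF _ sub]) auto
        also have "\<dots> \<le> (8 * d) ^ l" using d(2) by (intro power_mono) auto
        finally show ?thesis .
      qed
      show ?thesis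
        unfolding sparse_good_def
      proof (intro conjI ballI EV)
        fix l v c assume "l \<in> {..J}" "v \<in> ?V" "c \<in> ?V - {v}"
        moreover have "E \<notin> B3" using B by blast
        ultimately have "\<not> (real (card (gball (del_vertex v E) l c)) \<le> (8 * d) ^ l \<and>
            K l < real (card (nbrs E v \<inter> gball (del_vertex v E) l c)))"
          unfolding B3_def by blast
        then show "real (card (nbrs E v \<inter> gball (del_vertex v E) l c)) \<le> K l"
          using ball[of c v l] \<open>c \<in> ?V - {v}\<close> by simp
      qed (use deg in auto)
    qed
    then show "AE E in gnp n p. E \<in> {E. \<not> sparse_good n d J K E} \<longrightarrow> E \<in> B1 \<union> B2 \<union> B3"
      unfolding AE_measure_pmf_iff by blast
  qed auto
  also have "\<dots> \<le> measure_pmf.prob (gnp n p) B1 + measure_pmf.prob (gnp n p) B2 + measure_pmf.prob (gnp n p) B3"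
    by (intro order_trans[OF measure_Un_le] add_mono order_refl) auto
  also have "measure_pmf.prob (gnp n p) B1 \<le> real (card ?V) * exp (- d / 8)"
    unfolding B1_def d(1) using prob_degree_gt_le[OF p] by (intro prob_bex_le) auto
  also have "measure_pmf.prob (gnp n p) B2 \<le> real (card ?V) * exp (- d / 8)"
    unfolding B2_def d(1) using prob_degree_lt_le[OF p n] by (intro prob_bex_le) auto
  also have "measure_pmf.prob (gnp n p) B3 \<le> real (card {..J}) * (real (card ?V) * (real n * (1 / real n ^ 3)))"
    unfolding B3_def
  proof (intro prob_bex_le)
    fix l v assume l: "l \<in> {..J}" and v: "v \<in> ?V"
    have "measure_pmf.prob (gnp n p) {E. \<exists>c\<in>?V - {v}.
      real (card (gball (del_vertex v E) l c)) \<le> (8 * d) ^ l \<and>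
      K l < real (card (nbrs E v \<inter> gball (del_vertex v E) l c))} \<le> real (card (?V - {v})) * (1 / real n ^ 3)"
    proof (rule prob_bex_le)
      fix c assume "c \<in> ?V - {v}"
      then show "measure_pmf.prob (gnp n p) {E. real (card (gball (del_vertex v E) l c)) \<le> (8 * d) ^ l \<and>
          K l < real (card (nbrs E v \<inter> gball (del_vertex v E) l c))} \<le> 1 / real n ^ 3"
        using order_trans[OF prob_nbrs_gball_gt_le[OF p v, of c "a l" "(8 * d) ^ l" l "K l"] tail[of l]]
          a[of l] l d(2) by auto
    qed simp
    also have "\<dots> \<le> real n * (1 / real n ^ 3)"
      using card_mono[of ?V "?V - {v}"] by (intro mult_right_mono) auto
    finally show "measure_pmf.prob (gnp n p) {E. \<exists>c\<in>?V - {v}.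
      real (card (gball (del_vertex v E) l c)) \<le> (8 * d) ^ l \<and>
      K l < real (card (nbrs E v \<inter> gball (del_vertex v E) l c))} \<le> real n * (1 / real n ^ 3)" .
  qed auto
  also have "real (card {..J}) * (real (card ?V) * (real n * (1 / real n ^ 3))) = (real J + 1) / real n"
    using n0 by (simp add: power3_eq_cube field_simps)
  finally show ?thesis by simp
qed

section \<open>Asymptotics\<close>

text \<open>Source of the recurring threshold 3, the first integer above e.\<close>

lemma ln_ge_one: "3 \<le> n \<Longrightarrow> 1 \<le> ln (real n)"
  using e_less_272 by (subst ln_ge_iff) auto

lemma aasI:
  assumes "\<forall>\<^sub>F n in sequentially. measure_pmf.prob (gnp n (p n)) {E. \<not> Q n E} \<le> f n" "f \<longlonglongrightarrow> 0"
  shows "aas p Q"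
proof -
  have compl: "measure_pmf.prob (gnp n (p n)) {E. Q n E} =
      1 - measure_pmf.prob (gnp n (p n)) {E. \<not> Q n E}" for n
    using measure_pmf.prob_compl[of "{E. \<not> Q n E}" "gnp n (p n)"] by (simp add: Compl_eq_Diff_UNIV[symmetric] Collect_neg_eq)
  have "(\<lambda>n. 1 - f n) \<longlonglongrightarrow> 1 - 0" using assms(2) by (intro tendsto_intros)
  then have "(\<lambda>n. 1 - f n) \<longlonglongrightarrow> 1" by simp
  then show ?thesis
    unfolding aas_def
    by (rule tendsto_sandwich[rotated 2, OF _ tendsto_const])
       (use assms(1) in \<open>auto simp: compl elim: eventually_mono\<close>)
qed

lemma aas_mono:
  assumes "aas p Q" "\<forall>\<^sub>F n in sequentially. \<forall>E. Q n E \<longrightarrow> R n E"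
  shows "aas p R"
  unfolding aas_def
proof (rule tendsto_sandwich[OF _ _ assms(1)[unfolded aas_def] tendsto_const])
  show "\<forall>\<^sub>F n in sequentially. measure_pmf.prob (gnp n (p n)) {E. Q n E} \<le> measure_pmf.prob (gnp n (p n)) {E. R n E}"
    using assms(2) by eventually_elim (intro measure_pmf.finite_measure_mono, auto)
qed auto

lemma aas_conj:
  assumes "aas p Q" "aas p R"
  shows "aas p (\<lambda>n E. Q n E \<and> R n E)"
proof (rule aasI)
  let ?P = "\<lambda>n A. measure_pmf.prob (gnp n (p n)) A"
  show "(\<lambda>n. (1 - ?P n {E. Q n E}) + (1 - ?P n {E. R n E})) \<longlonglongrightarrow> 0"
    using assms unfolding aas_def by (auto intro!: tendsto_eq_intros)
  have "?P n {E. \<not> (Q n E \<and> R n E)} \<le> (1 - ?P n {E. Q n E}) + (1 - ?P n {E. R n E})" for n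
  proof -
    have "?P n {E. \<not> (Q n E \<and> R n E)} = ?P n ((UNIV - {E. Q n E}) \<union> (UNIV - {E. R n E}))"
      by (intro arg_cong2[where f = measure]) auto
    also have "\<dots> \<le> ?P n (UNIV - {E. Q n E}) + ?P n (UNIV - {E. R n E})"
      by (intro measure_Un_le) auto
    also have "\<dots> = (1 - ?P n {E. Q n E}) + (1 - ?P n {E. R n E})"
      using measure_pmf.prob_compl[of _ "gnp n (p n)"] by simp
    finally show ?thesis .
  qed
  then show "\<forall>\<^sub>F n in sequentially. ?P n {E. \<not> (Q n E \<and> R n E)} \<le> (1 - ?P n {E. Q n E}) + (1 - ?P n {E. R n E})"
    by simp
qed

text \<open>Turns a family of statements, one for each fixed tolerance, into one with a tolerance
  tending to 0. One number serves as tolerance and as failure probability: \<open>\<delta> n\<close>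
  is nearly the least value that works as both.\<close>

lemma aas_diagonal:
  assumes mono: "\<And>n E \<delta> \<delta>'. Q \<delta> n E \<Longrightarrow> \<delta> \<le> \<delta>' \<Longrightarrow> Q \<delta>' n E"
    and Q: "\<And>\<delta>::real. 0 < \<delta> \<Longrightarrow> aas p (Q \<delta>)"
  shows "\<exists>\<delta>. \<delta> \<longlonglongrightarrow> 0 \<and> aas p (\<lambda>n. Q (\<delta> n) n)"
proof -
  define pr where "pr n \<delta> = measure_pmf.prob (gnp n (p n)) {E. Q \<delta> n E}" for n \<delta>
  define S where "S n = {\<delta>. 0 < \<delta> \<and> 1 - \<delta> \<le> pr n \<delta>}" for n
  \<comment> \<open>The infimum need not be attained; the added term puts some element of
    \<open>S n\<close> strictly below \<open>\<delta> n\<close>.\<close>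
  define \<delta> where "\<delta> n = Inf (S n) + 1 / (real n + 1)" for n
  have pr_mono: "pr n d \<le> pr n d'" if "d \<le> d'" for n d d'
    unfolding pr_def using mono that by (intro measure_pmf.finite_measure_mono) auto
  have bdd: "bdd_below (S n)" for n unfolding S_def bdd_below_def by (auto intro!: exI[of _ 0])
  have one: "1 \<in> S n" for n by (simp add: S_def pr_def)
  have Inf0: "0 \<le> Inf (S n)" for n 
  proof (rule cInf_greatest)
    show "S n \<noteq> {}" using one[of n] by blast
  qed (simp add: S_def)
  have lim: "\<delta> \<longlonglongrightarrow> 0"
  proof (rule LIMSEQ_I)
    fix e :: real assume e: "0 < e"
    have "(\<lambda>n. pr n (e / 2)) \<longlonglongrightarrow> 1" using Q[of "e / 2"] e by (simp add: aas_def pr_def)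
    then have "\<forall>\<^sub>F n in sequentially. 1 - e / 2 < pr n (e / 2)"
      using e by (intro order_tendstoD) auto
    moreover have "\<forall>\<^sub>F n in sequentially. 1 / (real n + 1) < e / 2" using e by real_asymp
    ultimately have "\<forall>\<^sub>F n in sequentially. norm (\<delta> n - 0) < e"
    proof eventually_elim
      case (elim n)
      then have "Inf (S n) \<le> e / 2" using e bdd by (intro cInf_lower) (auto simp: S_def)
      then show ?case using elim Inf0[of n] by (simp add: \<delta>_def)
    qed
    then show "\<exists>N. \<forall>n\<ge>N. norm (\<delta> n - 0) < e" by (simp add: eventually_sequentially)
  qed
  have "1 - \<delta> n \<le> pr n (\<delta> n)" for n
  proof -
    have "Inf (S n) < \<delta> n" by (simp add: \<delta>_def)
    then obtain s where "s \<in> S n" "s < \<delta> n" using cInf_lessD[of "S n" "\<delta> n"] one by blast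
    then show ?thesis using pr_mono[of s "\<delta> n" n] by (simp add: S_def)
  qed
  note ge = this
  have lim1: "(\<lambda>n. 1 - \<delta> n) \<longlonglongrightarrow> 1" using tendsto_diff[OF tendsto_const lim, of 1] by simp
  have "(\<lambda>n. pr n (\<delta> n)) \<longlonglongrightarrow> 1"
  proof (rule tendsto_sandwich[OF _ _ lim1 tendsto_const])
    show "\<forall>\<^sub>F n in sequentially. 1 - \<delta> n \<le> pr n (\<delta> n)" using ge by simp
    show "\<forall>\<^sub>F n in sequentially. pr n (\<delta> n) \<le> 1" by (simp add: pr_def)
  qed
  then have "aas p (\<lambda>n. Q (\<delta> n) n)" by (simp add: aas_def pr_def)
  then show ?thesis using lim by blast
qed

lemma aas_upper:
  assumes p: "\<And>n. 0 \<le> p n \<and> p n \<le> 1" and k: "\<forall>\<^sub>F n in sequentially. k n \<le> n"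
    and b: "\<forall>\<^sub>F n in sequentially. real n * (1 - p n) ^ k n \<le> f n" "f \<longlonglongrightarrow> 0"
  shows "aas p (\<lambda>n E. cL n E \<le> real (k n))"
proof (rule aasI[OF _ b(2)])
  show "\<forall>\<^sub>F n in sequentially. measure_pmf.prob (gnp n (p n)) {E. \<not> cL n E \<le> real (k n)} \<le> f n"
    using k b(1)
  proof eventually_elim
    case (elim n)
    have "cL n E \<le> real (k n)" if "lazy_cops_win {1..n} E (k n)" for E
      using that unfolding cL_def lazy_cop_number_def by (simp add: Least_le)
    then have "measure_pmf.prob (gnp n (p n)) {E. \<not> cL n E \<le> real (k n)} \<le>
        measure_pmf.prob (gnp n (p n)) {E. \<not> lazy_cops_win {1..n} E (k n)}"
      by (intro measure_pmf.finite_measure_mono) auto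
    also have "\<dots> \<le> f n" using prob_not_dominated_le[of "p n" "k n" n] p elim by force
    finally show ?case .
  qed
qed

text \<open>The content of \<open>d = n powr (\<alpha> + o(1))\<close> that is used below, with \<open>n * p\<close> in place of \<open>d\<close>.\<close>

definition density_exponent :: "real \<Rightarrow> (nat \<Rightarrow> real) \<Rightarrow> bool" where
  "density_exponent \<alpha> p \<longleftrightarrow> (\<forall>\<eta>>0. \<forall>\<^sub>F n in sequentially.
     real n powr (\<alpha> - \<eta>) \<le> real n * p n \<and> real n * p n \<le> real n powr (\<alpha> + \<eta>))"

lemma density_exponentI:
  assumes "\<delta> \<longlonglongrightarrow> 0" and p: "\<And>n. 0 \<le> p n"
    and d: "\<forall>\<^sub>F n in sequentially. (real n - 1) * p n = real n powr (\<alpha> + \<delta> n)"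
  shows "density_exponent \<alpha> p"
  unfolding density_exponent_def
proof (intro allI impI)
  fix \<eta> :: real assume \<eta>: "0 < \<eta>"
  have "\<forall>\<^sub>F n in sequentially. \<bar>\<delta> n\<bar> < \<eta> / 2"
    using tendstoD[OF assms(1), of "\<eta> / 2"] \<eta> by (simp add: dist_real_def)
  \<comment> \<open>Passing from n - 1 to n costs a factor 2, paid with half of \<eta>.\<close>
  moreover have "\<forall>\<^sub>F n in sequentially. 2 \<le> real n powr (\<eta> / 2)" using \<eta> by real_asymp
  ultimately show "\<forall>\<^sub>F n in sequentially.
      real n powr (\<alpha> - \<eta>) \<le> real n * p n \<and> real n * p n \<le> real n powr (\<alpha> + \<eta>)"
    using d eventually_ge_at_top[of 2]
  proof eventually_elim
    case (elim n)
    have "real n powr (\<alpha> - \<eta>) \<le> real n powr (\<alpha> + \<delta> n)"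
      using elim \<eta> by (intro powr_mono) auto
    also have "\<dots> = (real n - 1) * p n" using elim by simp
    also have "\<dots> \<le> real n * p n" using p by (intro mult_right_mono) auto
    finally have lower: "real n powr (\<alpha> - \<eta>) \<le> real n * p n" .
    have "real n * p n \<le> (2 * (real n - 1)) * p n"
      using p elim by (intro mult_right_mono) auto
    also have "\<dots> = 2 * real n powr (\<alpha> + \<delta> n)" by (simp only: mult.assoc elim(3))
    also have "\<dots> \<le> real n powr (\<eta> / 2) * real n powr (\<alpha> + \<eta> / 2)"
      using elim by (intro mult_mono powr_mono) auto
    also have "\<dots> = real n powr (\<alpha> + \<eta>)" by (simp add: powr_add[symmetric] algebra_simps)
    finally show ?case using lower by simp
  qed
qed

lemma density_exponentD:
  assumes "density_exponent \<alpha> p" "0 < \<eta>"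
  shows "\<forall>\<^sub>F n in sequentially. real n powr (\<alpha> - \<eta>) \<le> real n * p n"
    "\<forall>\<^sub>F n in sequentially. real n * p n \<le> real n powr (\<alpha> + \<eta>)"
  using assms by (auto simp: density_exponent_def elim: eventually_mono)

lemma density_exponent_pos:
  assumes "density_exponent \<alpha> p"
  shows "\<forall>\<^sub>F n in sequentially. 0 < p n"
  using density_exponentD(1)[OF assms zero_less_one] eventually_gt_at_top[of 0]
proof eventually_elim
  case (elim n)
  then have "0 < real n powr (\<alpha> - 1)" by simp
  then have "0 < real n * p n" using elim by linarith
  then show ?case using elim by (simp add: zero_less_mult_iff)
qed

lemma density_exponent_ln_le:
  assumes "density_exponent \<alpha> p" "0 < \<alpha>"
  shows "\<forall>\<^sub>F n in sequentially. C * ln (real n) \<le> real n * p n"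
proof -
  have "\<forall>\<^sub>F n in sequentially. C * ln (real n) \<le> real n powr (\<alpha> - \<alpha> / 2)" using assms(2) by real_asymp
  then show ?thesis
    using density_exponentD(1)[OF assms(1), of "\<alpha> / 2"] assms(2)
    by (auto elim: eventually_elim2)
qed

lemma density_exponent_p_le:
  assumes "density_exponent \<alpha> p" "0 < \<eta>"
  shows "\<forall>\<^sub>F n in sequentially. p n \<le> real n powr (\<alpha> - 1 + \<eta>)"
  using density_exponentD(2)[OF assms] eventually_gt_at_top[of 0]
proof eventually_elim
  case (elim n)
  have "real n powr (\<alpha> + \<eta>) = real n * real n powr (\<alpha> - 1 + \<eta>)"
    using elim by (simp add: powr_mult_base algebra_simps)
  then show ?case using elim by simp
qed

lemma density_exponent_p_ge:
  assumes "density_exponent \<alpha> p" "0 < \<eta>"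
  shows "\<forall>\<^sub>F n in sequentially. real n powr (\<alpha> - 1 - \<eta>) \<le> p n"
  using density_exponentD(1)[OF assms] eventually_gt_at_top[of 0]
proof eventually_elim
  case (elim n)
  have "real n powr (\<alpha> - \<eta>) = real n * real n powr (\<alpha> - 1 - \<eta>)"
    using elim by (simp add: powr_mult_base algebra_simps)
  then show ?case using elim by simp
qed

section \<open>The general upper bound and the dense lower bound\<close>

lemma aas_cL_le_ln_div_p:
  assumes p: "\<And>n. 0 \<le> p n \<and> p n \<le> 1" and dens: "density_exponent \<alpha> p" and \<alpha>: "0 < \<alpha>"
  shows "aas p (\<lambda>n E. cL n E \<le> 3 * (ln (real n) / p n))"
proof -
  \<comment> \<open>The factor 2 makes \<open>n * (1 - p) ^ k\<close> at most 1 / n. Rounding up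
    turns it into 3, because ln n / p is at least 1.\<close>
  define k where "k n = nat \<lceil>2 * ln (real n) / p n\<rceil>" for n
  have ev: "\<forall>\<^sub>F n in sequentially. real (k n) \<le> 3 * (ln (real n) / p n) \<and> k n \<le> n \<and>
      real n * (1 - p n) ^ k n \<le> 1 / real n"
    using density_exponent_pos[OF dens] density_exponent_ln_le[OF dens \<alpha>, of 3]
      eventually_ge_at_top[of 3]
  proof eventually_elim
    case (elim n)
    have ln1: "1 \<le> ln (real n)" using ln_ge_one[OF elim(3)] .
    have q: "1 \<le> ln (real n) / p n" using ln1 p[of n] elim(1) by (simp add: le_divide_eq)
    have kge: "2 * ln (real n) / p n \<le> real (k n)" unfolding k_def by linarith
    have kle: "real (k n) \<le> 2 * ln (real n) / p n + 1" unfolding k_def using q by linarith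
    also have "\<dots> \<le> 3 * (ln (real n) / p n)" using q by simp
    finally have 1: "real (k n) \<le> 3 * (ln (real n) / p n)" .
    also have "\<dots> \<le> real n" using elim by (simp add: field_simps)
    finally have 2: "k n \<le> n" by simp
    have "(1 - p n) ^ k n \<le> exp (- p n) ^ k n"
      using p[of n] exp_ge_add_one_self[of "- p n"] by (intro power_mono) auto
    also have "\<dots> = exp (- (p n * real (k n)))" by (simp add: exp_of_nat_mult[symmetric] mult.commute)
    also have "\<dots> \<le> exp (- (2 * ln (real n)))"
      using kge elim(1) by (simp add: field_simps)
    also have "\<dots> = 1 / (real n)\<^sup>2" using elim(3) by (simp add: exp_minus exp_double field_simps)
    finally have "real n * (1 - p n) ^ k n \<le> real n * (1 / (real n)\<^sup>2)" by (intro mult_left_mono) auto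
    also have "\<dots> = 1 / real n" by (simp add: power2_eq_square)
    finally show ?case using 1 2 by simp
  qed
  have "aas p (\<lambda>n E. cL n E \<le> real (k n))"
    by (rule aas_upper[OF p, where f = "\<lambda>n. 1 / real n"])
       (use ev in \<open>auto elim: eventually_mono intro: lim_1_over_n\<close>)
  then show ?thesis by (rule aas_mono) (use ev in \<open>auto elim!: eventually_mono\<close>)
qed

text \<open>The expected number of escapes, about p n^(1 - \<gamma>), has to beat the entropy k ln n
  \<le> (ln n)^2 / p of the cop positions; so p^2 n^(1 - \<gamma>) must beat (ln n)^2, and
  \<open>pn\<close> makes it a power of n. \<open>\<gamma>\<close> measures how thin
  \<open>k\<close> cops make the set of vertices not adjacent to any of them.\<close>

lemma aas_lower_dense:
  assumes p: "\<And>n. 0 \<le> p n \<and> p n \<le> 1" and \<gamma>: "0 \<le> \<gamma>" and \<rho>: "0 < \<rho>"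
    and pos: "\<forall>\<^sub>F n in sequentially. 0 < p n"
    and k: "\<forall>\<^sub>F n in sequentially. real (k n) \<le> ln (real n) / p n"
    and pk: "\<forall>\<^sub>F n in sequentially. real n powr (- \<gamma>) \<le> (1 - p n) ^ k n"
    and pn: "\<forall>\<^sub>F n in sequentially. real n powr \<rho> \<le> (p n)\<^sup>2 * real n powr (1 - \<gamma>)"
  shows "aas p (\<lambda>n E. real (k n) \<le> cL n E)"
proof (rule aasI)
  show "(\<lambda>n. 1 / real n) \<longlonglongrightarrow> 0" by (rule lim_1_over_n)
  have "\<forall>\<^sub>F n in sequentially. 4 * ln (real n) \<le> real n powr \<rho>" using \<rho> by real_asymp
  moreover have "\<forall>\<^sub>F n in sequentially. 4 * (ln (real n))\<^sup>2 + 2 * ln (real n) \<le> real n powr \<rho>"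
    using \<rho> by real_asymp
  ultimately show "\<forall>\<^sub>F n in sequentially.
      measure_pmf.prob (gnp n (p n)) {E. \<not> real (k n) \<le> cL n E} \<le> 1 / real n"
    using pos k pk pn eventually_ge_at_top[of 3]
  proof eventually_elim
    case (elim n)
    have ln1: "1 \<le> ln (real n)" using ln_ge_one[OF elim(7)] .
    have q: "1 \<le> ln (real n) / p n" using ln1 p[of n] elim(3) by (simp add: le_divide_eq)
    then have k2: "real (k n) + 1 \<le> 2 * ln (real n) / p n" using elim(4) by simp
    have "real n powr \<rho> \<le> p n * (p n * real n powr (1 - \<gamma>))" using elim by (simp add: power2_eq_square mult_ac)
    also have "\<dots> \<le> 1 * (p n * real n powr 1)"
      using p[of n] elim(7) \<gamma> by (intro mult_mono powr_mono) auto
    finally have "4 * ln (real n) \<le> p n * real n" using elim by simp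
    then have "2 * ln (real n) / p n \<le> real n / 2" using elim(3) by (simp add: field_simps)
    then have kn: "real (k n) + 1 \<le> real n / 2" using k2 by linarith
    have "real (k n) < real n" using kn by linarith
    then have kn': "k n < n" by simp
    have "real n powr (- \<gamma>) * (real n / 2) \<le> (1 - p n) ^ k n * (real n - real (k n) - 1)"
      using elim kn p[of n] by (intro mult_mono) auto
    then have A: "p n * (real n powr (- \<gamma>) * (real n / 2)) \<le> p n * ((1 - p n) ^ k n * (real n - real (k n) - 1))"
      using p by (intro mult_left_mono) auto
    have B: "real n powr (- \<gamma>) * real n = real n powr (1 - \<gamma>)"
      using elim(7) by (simp add: powr_diff powr_minus field_simps)
    have "(real (k n) + 1) * ln (real n) - p n * ((1 - p n) ^ k n * (real n - real (k n) - 1))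
        \<le> 2 * ln (real n) / p n * ln (real n) - p n * (real n powr (- \<gamma>) * (real n / 2))"
      using A k2 ln1 by (intro diff_mono mult_right_mono) auto
    also have "\<dots> = (2 * (ln (real n))\<^sup>2 - (p n)\<^sup>2 * real n powr (1 - \<gamma>) / 2) / p n"
      using elim(3) by (simp add: B[symmetric] field_simps power2_eq_square)
    also have "\<dots> \<le> (- ln (real n)) / p n"
      using elim by (intro divide_right_mono) auto
    also have "\<dots> \<le> - ln (real n)"
      using elim(3) p[of n] ln1 by (simp add: field_simps mult_left_le)
    finally have C: "(real (k n) + 1) * ln (real n) - p n * ((1 - p n) ^ k n * (real n - real (k n) - 1)) \<le> - ln (real n)" .
    have "real (k n) \<le> cL n E" if "\<not> (\<exists>k'\<le>k n. lazy_cops_win {1..n} E k')" for E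
      unfolding cL_def by (rule lazy_cop_number_ge) (use that in auto)
    then have "measure_pmf.prob (gnp n (p n)) {E. \<not> real (k n) \<le> cL n E} \<le>
        measure_pmf.prob (gnp n (p n)) {E. \<exists>k'\<le>k n. lazy_cops_win {1..n} E k'}"
      by (intro measure_pmf.finite_measure_mono) (blast, simp)
    also have "\<dots> \<le> real n ^ (k n + 1) * exp (- (p n * (1 - p n) ^ k n * (real n - real (k n) - 1)))"
      using prob_dense_win_le[of "p n" "k n" n] p kn' by blast
    also have "real n ^ (k n + 1) = exp ((real (k n) + 1) * ln (real n))"
      using elim(7) exp_of_nat_mult[of "k n + 1" "ln (real n)"] by (simp add: add.commute)
    also have "exp ((real (k n) + 1) * ln (real n)) * exp (- (p n * (1 - p n) ^ k n * (real n - real (k n) - 1)))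
        = exp ((real (k n) + 1) * ln (real n) - p n * ((1 - p n) ^ k n * (real n - real (k n) - 1)))"
      by (simp add: exp_add[symmetric] mult.assoc)
    also have "\<dots> \<le> exp (- ln (real n))" using C by simp
    also have "\<dots> = 1 / real n" using elim(7) by (simp add: exp_minus field_simps)
    finally show ?case .
  qed
qed

text \<open>With base n^\<eta> the exponential factor is at most e, as the mean is at most n^(-
  \<eta>), and the constant threshold 4 / \<eta> already contributes n^(-4).\<close>

lemma powr_tail_le_inverse_cube:
  assumes n: "3 \<le> n" and \<eta>: "0 < \<eta>" and \<mu>: "\<mu> \<le> real n powr (- \<eta>)"
  shows "(real n powr \<eta>) powr (- (4 / \<eta>)) * exp (real n powr \<eta> * \<mu>) \<le> 1 / real n ^ 3"
proof -
  have "(real n powr \<eta>) powr (- (4 / \<eta>)) = real n powr - 4" using \<eta> by (simp add: powr_powr)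
  also have "\<dots> = 1 / real n ^ 4" using n by (simp add: powr_minus_divide)
  finally have "(real n powr \<eta>) powr (- (4 / \<eta>)) = 1 / real n ^ 4" .
  moreover have "exp (real n powr \<eta> * \<mu>) \<le> real n"
  proof -
    have "real n powr \<eta> * \<mu> \<le> real n powr \<eta> * real n powr (- \<eta>)" using \<mu> by (intro mult_left_mono) auto
    also have "\<dots> = 1" using n by (simp add: powr_add[symmetric])
    finally have "exp (real n powr \<eta> * \<mu>) \<le> exp 1" by simp
    then show ?thesis using n e_less_272 by linarith
  qed
  ultimately have "(real n powr \<eta>) powr (- (4 / \<eta>)) * exp (real n powr \<eta> * \<mu>) \<le> 1 / real n ^ 4 * real n"
    by (simp add: divide_right_mono)
  also have "\<dots> = 1 / real n ^ 3" using n by (simp add: eval_nat_numeral)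
  finally show ?thesis .
qed

text \<open>With base 2 and ln 2 \<ge> 2/3, the term 4 \<mu> outweighs
  \<open>exp (2 * \<mu>)\<close> and 5 ln n supplies n^(-3).\<close>

lemma two_powr_tail_le_inverse_cube:
  assumes n: "3 \<le> n" and \<mu>: "0 \<le> \<mu>"
  shows "2 powr (- (4 * \<mu> + 5 * ln (real n))) * exp (2 * \<mu>) \<le> 1 / real n ^ 3"
proof -
  have ln1: "1 \<le> ln (real n)" using ln_ge_one[OF n] .
  have "2 powr (- (4 * \<mu> + 5 * ln (real n))) * exp (2 * \<mu>) =
      exp (2 * \<mu> - ln 2 * (4 * \<mu> + 5 * ln (real n)))"
    by (simp add: powr_def exp_add[symmetric] algebra_simps)
  also have "\<dots> \<le> exp (- (3 * ln (real n)))"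
  proof -
    have "2 / 3 * (4 * \<mu> + 5 * ln (real n)) \<le> ln 2 * (4 * \<mu> + 5 * ln (real n))"
      using ln2_ge_two_thirds \<mu> ln1 by (intro mult_right_mono) auto
    then have "2 * \<mu> - ln 2 * (4 * \<mu> + 5 * ln (real n)) \<le> - (3 * ln (real n))"
      using \<mu> ln1 by (simp add: algebra_simps)
    then show ?thesis by simp
  qed
  also have "\<dots> = 1 / real n ^ 3"
    using n exp_of_nat_mult[of 3 "ln (real n)"] by (simp add: exp_minus field_simps)
  finally show ?thesis .
qed

text \<open>Up to radius \<open>J - 2\<close> the expected number of neighbours of \<open>v\<close> in a ball is polynomially
  small, so that a constant \<open>4 / \<eta>\<close> bounds it simultaneously for all pairs; \<open>K'\<close> is the bound
  for radius \<open>J - 1\<close>, where either estimate may apply.\<close>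

lemma prob_lower_sparse_le:
  fixes \<eta> K' x :: real
  assumes p: "0 \<le> p" "p \<le> 1" and n: "3 \<le> n" and d: "d = real n * p" and J: "1 \<le> J"
    and \<eta>: "0 < \<eta>" "\<eta> \<le> 1"
    and small: "\<And>l. Suc l < J \<Longrightarrow> (8 * d) ^ l * p \<le> real n powr (- \<eta>)"
    and K': "K' = 4 * ((8 * d) ^ (J - 1) * p) + 5 * ln (real n) \<or>
      K' = 4 / \<eta> \<and> (8 * d) ^ (J - 1) * p \<le> real n powr (- \<eta>)"
    and d\<eta>: "512 * (4 / \<eta>) \<le> d" and dK': "512 * K' \<le> d"
    and Q: "Q = (2048 / \<eta>) ^ (J - 1) * (512 * K')"
    and x1: "x * p * (real J + 1) * Q < 64"
    and x2: "x * p * Q * (4 * ((8 * d) ^ J * p) + 5 * ln (real n)) \<le> 4 * ((8 * d) ^ J * p)"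
  shows "measure_pmf.prob (gnp n p) {E. \<not> x \<le> cL n E} \<le> 2 * real n * exp (- d / 8) + (real J + 1) / real n"
proof -
  define \<mu> where "\<mu> l = (8 * d) ^ l * p" for l
  \<comment> \<open>The product \<open>Q\<close> only involves radii below \<open>J\<close> and
    should stay small; at radius \<open>J\<close> the bound is compared with the mean itself in
    \<open>x2\<close>, so it may be of that order.\<close>
  define K where "K l = (if Suc l < J then 4 / \<eta> else if Suc l = J then K' else 4 * \<mu> l + 5 * ln (real n))" for l
  \<comment> \<open>The base that fits the bound: n^\<eta> for the constant one, 2 for the one with
    the mean and ln n.\<close>
  define a where "a l = (if Suc l < J \<or> Suc l = J \<and> K' = 4 / \<eta> \<and> \<mu> l \<le> real n powr (- \<eta>)
    then real n powr \<eta> else 2)" for l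
  have ln1: "1 \<le> ln (real n)" using ln_ge_one[OF n] .
  have \<eta>4: "4 \<le> 4 / \<eta>" using \<eta> by (simp add: field_simps)
  have d1: "1 \<le> d" using d\<eta> \<eta>4 by linarith
  have p0: "0 < p" using d1 d p n by (cases "p = 0") auto
  have n0: "0 < real n" using n by simp
  have \<mu>0: "0 \<le> \<mu> l" for l using d1 p by (simp add: \<mu>_def)
  have K'1: "1 \<le> K'" using K' \<eta>4 \<mu>0[of "J - 1"] ln1 unfolding \<mu>_def by (elim disjE conjE) linarith+
  have K1: "1 \<le> K l" for l using K'1 \<eta>4 \<mu>0[of l] ln1 by (auto simp: K_def)
  have tail: "a l powr (- K l) * exp (a l * \<mu> l) \<le> 1 / real n ^ 3" if lJ: "l \<le> J" for l
  proof -
    consider "Suc l < J" | "Suc l = J" | "l = J" using lJ by linarith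
    then show ?thesis
    proof cases
      case 1 then show ?thesis
        using powr_tail_le_inverse_cube[OF n \<eta>(1), of "\<mu> l"] small[of l] by (simp add: a_def K_def \<mu>_def)
    next
      case 2
      then have l: "J - 1 = l" by simp
      show ?thesis
      proof (cases "K' = 4 / \<eta> \<and> \<mu> l \<le> real n powr (- \<eta>)")
        case True then show ?thesis using 2 powr_tail_le_inverse_cube[OF n \<eta>(1), of "\<mu> l"] by (simp add: a_def K_def)
      next
        case False
        then have "K' = 4 * \<mu> l + 5 * ln (real n)" using K' l by (auto simp: \<mu>_def)
        moreover have "K l = K'" using 2 by (simp add: K_def)
        moreover have "a l = 2" unfolding a_def using 2 False by (intro if_not_P) auto
        ultimately show ?thesis using two_powr_tail_le_inverse_cube[OF n \<mu>0, of l] by metis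
      qed
    next
      case 3 then show ?thesis using two_powr_tail_le_inverse_cube[OF n \<mu>0, of l] by (simp add: a_def K_def)
    qed
  qed
  have a1: "1 \<le> a l" for l using n \<eta> by (simp add: a_def ge_one_powr_ge_zero)
  have prodK: "(\<Prod>l<J. 512 * K l) = Q"
  proof -
    obtain J' where J': "J = Suc J'" using J by (cases J) auto
    have "(\<Prod>l<J'. 512 * K l) = (\<Prod>l<J'. 2048 / \<eta>)" by (rule prod.cong) (auto simp: K_def J')
    then show ?thesis by (simp add: J' Q K_def)
  qed
  have Q0: "0 \<le> Q" using K'1 \<eta> by (simp add: Q)
  have win: "x \<le> cL n E" if good: "sparse_good n d J K E" for E
    unfolding cL_def
  proof (rule lazy_cop_number_ge)
    fix k assume k: "real k \<le> x"
    have kp: "real k * p * (real J + 1) * Q \<le> x * p * (real J + 1) * Q"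
      using k p Q0 by (intro mult_right_mono) auto
    \<comment> \<open>Substituting d = n p cancels \<open>n\<close>, so the start condition becomes
      \<open>x1\<close>; the outer condition becomes \<open>x2\<close> after multiplication by
      \<open>p\<close>.\<close>
    have eq: "real k * d * (real J + 1) * (\<Prod>l<J. 512 * K l) = real n * (real k * p * (real J + 1) * Q)"
      unfolding prodK d by (simp add: mult_ac)
    have "real n * (real k * p * (real J + 1) * Q) < real n * 64"
      using kp x1 n0 by (intro mult_strict_left_mono) auto
    then have k1: "real k * d * (real J + 1) * (\<Prod>l<J. 512 * K l) < 64 * real n"
      unfolding eq by (simp add: mult.commute)
    have KJ: "K J = 4 * \<mu> J + 5 * ln (real n)" by (simp add: K_def)
    have "p * (real k * Q * K J) = real k * (p * Q * K J)" by (simp add: mult_ac)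
    also have "\<dots> \<le> x * (p * Q * K J)" using k p Q0 K1[of J] by (intro mult_right_mono) auto
    also have "\<dots> \<le> p * (4 * (8 * d) ^ J)"
      using x2 unfolding KJ \<mu>_def by (simp add: mult_ac)
    finally have k2: "real k * (\<Prod>l<J. 512 * K l) * K J \<le> 4 * (8 * d) ^ J"
      unfolding prodK using p0 by (simp only: mult_le_cancel_left_pos)
    have Kd: "512 * K l \<le> d" if "l < J" for l using that d\<eta> dK' by (auto simp: K_def)
    show "\<not> lazy_cops_win {1..n} E k"
      by (rule robber_wins_sparse[OF good _ d1 J K1 Kd k1 k2]) (use n in auto)
  qed simp
  have "measure_pmf.prob (gnp n p) {E. \<not> x \<le> cL n E} \<le> measure_pmf.prob (gnp n p) {E. \<not> sparse_good n d J K E}"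
    by (intro measure_pmf.finite_measure_mono) (use win in auto)
  also have "\<dots> \<le> 2 * real n * exp (- d / 8) + (real J + 1) / real n"
    by (rule prob_not_sparse_good_le[OF p _ d d1 a1]) (use n tail[unfolded \<mu>_def] in auto)
  finally show ?thesis .
qed

text \<open>n p is eventually at least 16 ln n, so the degree term is at most 2 / n.\<close>

lemma aas_lower_sparse:
  assumes dens: "density_exponent \<alpha> p" and \<alpha>: "0 < \<alpha>"
    and b: "\<forall>\<^sub>F n in sequentially. measure_pmf.prob (gnp n (p n)) {E. \<not> Q n E} \<le>
      2 * real n * exp (- (real n * p n) / 8) + (real j + 1) / real n"
  shows "aas p Q"
proof (rule aasI)
  show "(\<lambda>n. 2 / real n + (real j + 1) / real n) \<longlonglongrightarrow> 0" by real_asymp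
  show "\<forall>\<^sub>F n in sequentially. measure_pmf.prob (gnp n (p n)) {E. \<not> Q n E} \<le> 2 / real n + (real j + 1) / real n"
    using b density_exponent_ln_le[OF dens \<alpha>, of 16] eventually_gt_at_top[of 0]
  proof eventually_elim
    case (elim n)
    have "exp (- (real n * p n) / 8) \<le> exp (- (2 * ln (real n)))" using elim by simp
    also have "\<dots> = 1 / (real n)\<^sup>2" using elim by (simp add: exp_minus exp_double field_simps)
    finally have "2 * real n * exp (- (real n * p n) / 8) \<le> 2 * real n * (1 / (real n)\<^sup>2)"
      by (intro mult_left_mono) auto
    also have "\<dots> = 2 / real n" by (simp add: power2_eq_square)
    finally show ?case using elim by simp
  qed
qed

text \<open>\<open>n * \<mu>\<close> with \<open>\<mu> = (8 * d) ^ l * p\<close> is \<open>8 ^ l * d ^ (l + 1)\<close>.\<close>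

lemma density_exponent_layer_le:
  assumes dens: "density_exponent \<alpha> p" and \<alpha>: "0 < \<alpha>" and p: "\<And>n. 0 \<le> p n"
    and \<eta>: "real m * \<alpha> < 1 - \<eta>"
  shows "\<forall>\<^sub>F n in sequentially. \<forall>l<m. (8 * (real n * p n)) ^ l * p n \<le> real n powr (- \<eta>)"
proof -
  \<comment> \<open>Half of the gap in the hypothesis, shared among m + 1 factors: m (\<alpha> +
    \<theta>) - 1 stays below - \<eta> with room for the constant \<open>8 ^ m\<close>.\<close>
  define \<theta> where "\<theta> = (1 - \<eta> - real m * \<alpha>) / (2 * (real m + 1))"
  have \<theta>: "0 < \<theta>" using \<eta> by (simp add: \<theta>_def)
  have "2 * (real m + 1) * \<theta> = 1 - \<eta> - real m * \<alpha>" by (simp add: \<theta>_def)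
  moreover have "2 * (real m + 1) * \<theta> = 2 * (real m * \<theta>) + 2 * \<theta>" by (simp add: algebra_simps)
  moreover have "0 \<le> real m * \<theta>" using \<theta> by simp
  ultimately have ex: "real m * (\<alpha> + \<theta>) - 1 < - \<eta>"
    using \<theta> unfolding distrib_left by linarith
  have "\<forall>\<^sub>F n in sequentially. 8 ^ m * real n powr (real m * (\<alpha> + \<theta>) - 1) \<le> real n powr (- \<eta>)"
    using ex by real_asymp
  then show ?thesis
    using density_exponentD(2)[OF dens \<theta>] eventually_ge_at_top[of 3] density_exponent_ln_le[OF dens \<alpha>, of 1]
  proof eventually_elim
    case (elim n)
    define d where "d = real n * p n"
    have d1: "1 \<le> d" using ln_ge_one[OF elim(3)] elim(4) by (simp add: d_def)
    show ?case
    proof (intro allI impI)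
      fix l assume l: "l < m"
      have "real n * ((8 * d) ^ l * p n) = 8 ^ l * d ^ Suc l" by (simp add: d_def power_mult_distrib)
      also have "\<dots> \<le> 8 ^ m * d ^ m" using d1 l by (intro mult_mono power_increasing) auto
      also have "\<dots> \<le> 8 ^ m * (real n powr (\<alpha> + \<theta>)) ^ m"
        using elim(2) d1 by (intro mult_left_mono power_mono) (auto simp: d_def)
      also have "(real n powr (\<alpha> + \<theta>)) ^ m = real n powr (real m * (\<alpha> + \<theta>))"
        using elim(3) by (simp add: powr_realpow[symmetric] powr_powr mult.commute)
      also have "\<dots> = real n * real n powr (real m * (\<alpha> + \<theta>) - 1)"
        using elim(3) by (simp add: powr_mult_base)
      finally have "real n * ((8 * d) ^ l * p n) \<le> real n * (8 ^ m * real n powr (real m * (\<alpha> + \<theta>) - 1))"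
        by (simp only: mult.left_commute)
      moreover have "0 < real n" using elim(3) by simp
      ultimately have "(8 * d) ^ l * p n \<le> 8 ^ m * real n powr (real m * (\<alpha> + \<theta>) - 1)"
        by (rule mult_left_le_imp_le)
      then show "(8 * (real n * p n)) ^ l * p n \<le> real n powr (- \<eta>)" using elim(1) unfolding d_def by linarith
    qed
  qed
qed

lemma density_exponent_layer_ge:
  assumes dens: "density_exponent \<alpha> p" and \<alpha>: "1 < (real m + 1) * \<alpha>"
  shows "\<forall>\<^sub>F n in sequentially. C * ln (real n) \<le> (8 * (real n * p n)) ^ m * p n"
proof -
  define \<theta> where "\<theta> = ((real m + 1) * \<alpha> - 1) / (2 * (real m + 1))"
  have \<theta>: "0 < \<theta>" using \<alpha> by (simp add: \<theta>_def)
  have "2 * (real m + 1) * \<theta> = (real m + 1) * \<alpha> - 1" by (simp add: \<theta>_def)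
  moreover have "2 * (real m + 1) * \<theta> = 2 * ((real m + 1) * \<theta>)" by simp
  ultimately have ex: "0 < (real m + 1) * (\<alpha> - \<theta>) - 1"
    using \<alpha> unfolding right_diff_distrib by linarith
  have "\<forall>\<^sub>F n in sequentially. C * ln (real n) \<le> real n powr ((real m + 1) * (\<alpha> - \<theta>) - 1)"
    using ex by real_asymp
  then show ?thesis
    using density_exponentD(1)[OF dens \<theta>] eventually_ge_at_top[of 3]
  proof eventually_elim
    case (elim n)
    define d where "d = real n * p n"
    have "real n * real n powr ((real m + 1) * (\<alpha> - \<theta>) - 1) = (real n powr (\<alpha> - \<theta>)) ^ Suc m"
      using elim(3) by (simp add: powr_mult_base powr_realpow[symmetric] powr_powr mult.commute add.commute del: power_Suc)
    also have "\<dots> \<le> d ^ Suc m" using elim(2) by (intro power_mono) (auto simp: d_def)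
    also have "\<dots> = 1 ^ m * d ^ Suc m" by simp
    also have "\<dots> \<le> 8 ^ m * d ^ Suc m"
    proof (intro mult_right_mono power_mono)
      show "0 \<le> d ^ Suc m"
        using elim(2) powr_ge_zero[of "real n" "\<alpha> - \<theta>"] unfolding d_def by (intro zero_le_power) linarith
    qed auto
    also have "\<dots> = real n * ((8 * d) ^ m * p n)" by (simp add: d_def power_mult_distrib)
    finally have "real n powr ((real m + 1) * (\<alpha> - \<theta>) - 1) \<le> (8 * d) ^ m * p n"
      by (rule mult_left_le_imp_le) (use elim(3) in simp)
    then show ?case using elim(1) unfolding d_def by linarith
  qed
qed

text \<open>With cut-off radius \<open>j\<close> no logarithm is lost: up to radius j - 1 the means
  are polynomially small, so \<open>Q\<close> is a constant, and at radius \<open>j\<close> the mean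
  exceeds 5 ln n, so the bound there is at most 5 times the mean.\<close>

lemma aas_lower_noncritical:
  assumes p: "\<And>n. 0 \<le> p n \<and> p n \<le> 1" and dens: "density_exponent \<alpha> p" and \<alpha>: "0 < \<alpha>"
    and j: "1 \<le> j" "real j * \<alpha> < 1" "1 < (real j + 1) * \<alpha>"
  shows "\<exists>c>0. aas p (\<lambda>n E. c / p n \<le> cL n E)"
proof -
  define t where "t = real j * \<alpha>"
  have t: "0 \<le> t" "t < 1" using j(2) \<alpha> by (auto simp: t_def)
  define \<eta> where "\<eta> = (1 - t) / 2"
  have \<eta>: "0 < \<eta>" "\<eta> \<le> 1" using t by (auto simp: \<eta>_def)
  have j\<eta>: "real j * \<alpha> < 1 - \<eta>" unfolding t_def[symmetric] \<eta>_def using t(2) by (simp add: field_simps)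
  define Q where "Q = (2048 / \<eta>) ^ (j - 1) * (512 * (4 / \<eta>))"
  define c where "c = 1 / ((real j + 1) * Q)"
  have Q0: "0 < Q" using \<eta> by (simp add: Q_def)
  then have c0: "0 < c" by (simp add: c_def)
  have "aas p (\<lambda>n E. c / p n \<le> cL n E)"
  proof (rule aas_lower_sparse[OF dens \<alpha>])
    show "\<forall>\<^sub>F n in sequentially. measure_pmf.prob (gnp n (p n)) {E. \<not> c / p n \<le> cL n E} \<le>
        2 * real n * exp (- (real n * p n) / 8) + (real j + 1) / real n"
      using density_exponent_layer_le[OF dens \<alpha> conjunct1[OF p] j\<eta>]
        density_exponent_layer_ge[OF dens j(3), of 5] density_exponent_pos[OF dens]
        density_exponent_ln_le[OF dens \<alpha>, of "2048 / \<eta>"] eventually_ge_at_top[of 3]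
    proof eventually_elim
      case (elim n)
      define \<mu> where "\<mu> = (8 * (real n * p n)) ^ j * p n"
      have "2048 / \<eta> * 1 \<le> 2048 / \<eta> * ln (real n)"
        using \<eta> ln_ge_one[OF elim(5)] by (intro mult_left_mono) auto
      then have d\<eta>: "512 * (4 / \<eta>) \<le> real n * p n" using elim(4) by simp
      have xp: "c / p n * p n = c" using elim(3) by simp
      have cQ: "c * Q = 1 / (real j + 1)" using Q0 by (simp add: c_def)
      have \<mu>0: "0 \<le> \<mu>" using p[of n] by (simp add: \<mu>_def)
      show ?case
      proof (rule prob_lower_sparse_le[where \<eta> = \<eta> and K' = "4 / \<eta>" and Q = Q])
        show "4 / \<eta> = 4 * ((8 * (real n * p n)) ^ (j - 1) * p n) + 5 * ln (real n) \<or>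
            4 / \<eta> = 4 / \<eta> \<and> (8 * (real n * p n)) ^ (j - 1) * p n \<le> real n powr - \<eta>"
          using elim(1) j(1) by simp
        show "c / p n * p n * (real j + 1) * Q < 64"
        proof -
          have j0: "real j + 1 \<noteq> 0" by linarith
          have "c * (real j + 1) * Q = c * Q * (real j + 1)" by (simp only: mult_ac)
          also have "\<dots> = 1" using cQ unfolding nonzero_eq_divide_eq[OF j0] .
          finally show ?thesis unfolding xp by linarith
        qed
        have "c / p n * p n * Q * (4 * \<mu> + 5 * ln (real n)) = (4 * \<mu> + 5 * ln (real n)) / (real j + 1)"
          unfolding xp using cQ by simp
        also have "\<dots> \<le> (5 * \<mu>) / (1 + 1)"
          using elim(2)[folded \<mu>_def] \<mu>0 j(1) by (intro frac_le) auto
        also have "\<dots> \<le> 4 * \<mu>" using \<mu>0 by simp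
        finally show "c / p n * p n * Q * (4 * ((8 * (real n * p n)) ^ j * p n) + 5 * ln (real n))
            \<le> 4 * ((8 * (real n * p n)) ^ j * p n)" unfolding \<mu>_def .
      qed (use p elim \<eta> j(1) d\<eta> in \<open>auto simp: Q_def\<close>)
    qed
  qed
  then show ?thesis using c0 by blast
qed

text \<open>One logarithm allows for \<open>K'\<close> \<le> 9 ln n at radius J - 1. The other
  allows for an outer mean \<mu> known only to be at least 1, where 4 \<mu> + 5 ln n is bounded by 9
  \<mu> ln n.\<close>

lemma aas_lower_critical:
  assumes p: "\<And>n. 0 \<le> p n \<and> p n \<le> 1" and dens: "density_exponent \<alpha> p"
    and j: "2 \<le> j" and \<alpha>: "\<alpha> = 1 / real j"
  shows "\<exists>c>0. aas p (\<lambda>n E. c / (p n * (ln (real n))\<^sup>2) \<le> cL n E)"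
proof -
  \<comment> \<open>Then (j - 1) \<alpha> = 1 - 2 \<eta>, so all radii below j - 1 have mean at most
    n^(- \<eta>).\<close>
  define \<eta> where "\<eta> = 1 / (2 * real j)"
  have \<eta>: "0 < \<eta>" "\<eta> \<le> 1" using j by (auto simp: \<eta>_def)
  have \<alpha>0: "0 < \<alpha>" using j \<alpha> by simp
  have j\<eta>: "real (j - 1) * \<alpha> < 1 - \<eta>" using j by (simp add: \<eta>_def \<alpha> of_nat_diff field_simps)
  have j\<alpha>: "1 < (real j + 1) * \<alpha>" using j by (simp add: \<alpha> field_simps)
  \<comment> \<open>4608 = 512 * 9, so \<open>Q * ln n\<close> bounds the product of the layer
    factors when \<open>K'\<close> is at most 9 ln n.\<close>
  define Q where "Q = (2048 / \<eta>) ^ (j - 1) * 4608"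
  define c where "c = 1 / (9 * (real j + 1) * Q)"
  have Q0: "0 < Q" using \<eta> by (simp add: Q_def)
  then have c0: "0 < c" by (simp add: c_def)
  have "\<forall>\<^sub>F n in sequentially. 4 / \<eta> \<le> 9 * ln (real n)" by real_asymp
  note ev = this density_exponent_layer_le[OF dens \<alpha>0 conjunct1[OF p] j\<eta>]
        density_exponent_layer_ge[OF dens j\<alpha>, of 1] density_exponent_pos[OF dens]
        density_exponent_ln_le[OF dens \<alpha>0, of 4608] eventually_ge_at_top[of 3]
  have "aas p (\<lambda>n E. c / (p n * (ln (real n))\<^sup>2) \<le> cL n E)"
  proof (rule aas_lower_sparse[OF dens \<alpha>0])
    show "\<forall>\<^sub>F n in sequentially. measure_pmf.prob (gnp n (p n)) {E. \<not> c / (p n * (ln (real n))\<^sup>2) \<le> cL n E} \<le>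
        2 * real n * exp (- (real n * p n) / 8) + (real j + 1) / real n"
      using ev
    proof eventually_elim
      case (elim n)
      define d where "d = real n * p n"
      define x where "x = c / (p n * (ln (real n))\<^sup>2)"
      have ln1: "1 \<le> ln (real n)" using ln_ge_one[OF elim(6)] .
      have x0: "0 \<le> x" using c0 p[of n] by (simp add: x_def)
      have xp: "x * p n = c / (ln (real n))\<^sup>2" using elim(4) by (simp add: x_def)
      have bound: "measure_pmf.prob (gnp n (p n)) {E. \<not> x \<le> cL n E} \<le>
          2 * real n * exp (- d / 8) + (real j + 1) / real n"
        if J: "1 \<le> J" "J \<le> j" and \<mu>: "1 \<le> (8 * d) ^ J * p n"
          and K': "K' = 4 * ((8 * d) ^ (J - 1) * p n) + 5 * ln (real n) \<or>
            K' = 4 / \<eta> \<and> (8 * d) ^ (J - 1) * p n \<le> real n powr (- \<eta>)"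
          and K'9: "0 \<le> K'" "K' \<le> 9 * ln (real n)" for J K'
      proof -
        define q where "q = (2048 / \<eta>) ^ (J - 1) * (512 * K')"
        define \<mu> where "\<mu> = (8 * d) ^ J * p n"
        have \<mu>1: "1 \<le> \<mu>" using \<open>1 \<le> (8 * d) ^ J * p n\<close> by (simp add: \<mu>_def)
        have q0: "0 \<le> q" using K'9 \<eta> by (simp add: q_def)
        have "q \<le> (2048 / \<eta>) ^ (j - 1) * (512 * (9 * ln (real n)))"
          unfolding q_def using J K'9 \<eta> by (intro mult_mono power_increasing) (auto simp: field_simps)
        then have qQ: "q \<le> Q * ln (real n)" by (simp add: Q_def)
        have "x * p n * q \<le> c / (ln (real n))\<^sup>2 * (Q * ln (real n))"
          unfolding xp using qQ c0 by (intro mult_left_mono) auto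
        also have "\<dots> = c * Q / ln (real n)" using ln1 by (simp add: power2_eq_square)
        also have "\<dots> = 1 / (9 * (real j + 1) * ln (real n))" using Q0 by (simp add: c_def)
        finally have xq: "x * p n * q \<le> 1 / (9 * (real j + 1) * ln (real n))" .
        have d\<eta>: "512 * (4 / \<eta>) \<le> d" using elim(1,5) by (simp add: d_def)
        have dK': "512 * K' \<le> d" using K'9 elim(5) by (simp add: d_def)
        have "measure_pmf.prob (gnp n (p n)) {E. \<not> x \<le> cL n E} \<le>
            2 * real n * exp (- d / 8) + (real J + 1) / real n"
        proof (rule prob_lower_sparse_le[where \<eta> = \<eta> and K' = K' and Q = q])
          show "(8 * d) ^ l * p n \<le> real n powr - \<eta>" if "Suc l < J" for l
            using elim(2) that J by (simp add: d_def)
          have "x * p n * (real J + 1) * q = x * p n * q * (real J + 1)" by (simp add: mult_ac)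
          also have "\<dots> \<le> 1 / (9 * (real j + 1) * ln (real n)) * (real j + 1)"
            using xq J x0 p[of n] q0 ln1 by (intro mult_mono) auto
          also have "\<dots> = 1 / (9 * ln (real n))"
          proof -
            have "1 / (9 * a * b) * a = 1 / (9 * b)" if "a \<noteq> 0" for a b :: real using that by simp
            then show ?thesis by (metis add_nonneg_eq_0_iff of_nat_0_le_iff zero_le_one zero_neq_one)
          qed
          also have "\<dots> < 64" using ln1 by (simp add: field_simps)
          finally show "x * p n * (real J + 1) * q < 64" .
          have ln_\<mu>: "ln (real n) \<le> ln (real n) * \<mu>" "\<mu> \<le> ln (real n) * \<mu>" using \<mu>1 ln1 by auto
          then have "4 * \<mu> + 5 * ln (real n) \<le> 9 * ln (real n) * \<mu>" by simp
          then have "x * p n * q * (4 * \<mu> + 5 * ln (real n)) \<le>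
              1 / (9 * (real j + 1) * ln (real n)) * (9 * ln (real n) * \<mu>)"
            using xq \<mu>1 ln1 by (intro mult_mono) auto
          also have "\<dots> = \<mu> / (real j + 1)"
          proof -
            have "1 / (9 * a * b) * (9 * b * m) = m / a" if "b \<noteq> 0" for a b m :: real
              using that by (cases "a = 0") (simp_all add: field_simps)
            from this[of "ln (real n)" "real j + 1" \<mu>] show ?thesis using ln1 by linarith
          qed
          also have "\<dots> \<le> \<mu> / 1" using \<mu>1 by (intro divide_left_mono) auto
          also have "\<dots> \<le> 4 * \<mu>" using \<mu>1 by simp
          finally show "x * p n * q * (4 * ((8 * d) ^ J * p n) + 5 * ln (real n)) \<le> 4 * ((8 * d) ^ J * p n)"
            unfolding \<mu>_def .
        qed (use p elim(6) d_def J \<eta> K' d\<eta> dK' q_def in auto)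
        also have "(real J + 1) / real n \<le> (real j + 1) / real n"
          using J by (intro divide_right_mono) auto
        finally show ?thesis by simp
      qed
      have "0 \<le> (8 * d) ^ (j - 1) * p n" using p[of n] by (simp add: d_def)
      \<comment> \<open>\<open>d ^ j\<close> may lie on either side of \<open>n\<close>; the cut-off radius is \<open>j\<close> or \<open>j - 1\<close> accordingly.\<close>
      show ?case
      proof (cases "(8 * d) ^ (j - 1) * p n \<le> 1")
        case True
        have "1 \<le> (8 * d) ^ j * p n" using elim(3) ln1 by (simp add: d_def)
        then show ?thesis
          using bound[of j "4 * ((8 * d) ^ (j - 1) * p n) + 5 * ln (real n)"] True j ln1
            \<open>0 \<le> (8 * d) ^ (j - 1) * p n\<close> by (simp add: d_def x_def)
      next
        case False
        \<comment> \<open>Radius j - 1 has mean above 1 and can be outermost; the radius below it is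
          in the polynomially small range, so \<open>K'\<close> is the constant 4 / \<eta>.\<close>
        have "(8 * d) ^ (j - 1 - 1) * p n \<le> real n powr (- \<eta>)" using elim(2) j by (simp add: d_def)
        then show ?thesis
          using bound[of "j - 1" "4 / \<eta>"] False j elim(1) \<eta> by (simp add: d_def x_def)
      qed
    qed
  qed
  then show ?thesis using c0 by blast
qed

lemma aas_lower_ln_div_p:
  assumes p: "\<And>n. 0 \<le> p n \<and> p n \<le> 1" and dens: "density_exponent \<alpha> p" and \<alpha>: "1 / 2 < \<alpha>" "\<alpha> < 1"
  shows "\<exists>c>0. aas p (\<lambda>n E. c * (ln (real n) / p n) \<le> cL n E)"
proof -
  \<comment> \<open>From p \<ge> n^(\<alpha> - 1 - c) follows p^2 n^(1 - 2c) \<ge> n^(2\<alpha> - 1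
    - 4c) = n^(4c); this fixes the 8 and the values of \<open>\<gamma>\<close> and
    \<open>\<rho>\<close> below.\<close>
  define c where "c = (2 * \<alpha> - 1) / 8"
  have c0: "0 < c" and c1: "c \<le> 1" using \<alpha> by (auto simp: c_def)
  define k where "k n = nat \<lfloor>c * (ln (real n) / p n)\<rfloor>" for n
  define \<theta> where "\<theta> = (1 - \<alpha>) / 2"
  have \<theta>: "0 < \<theta>" "\<alpha> - 1 + \<theta> = - \<theta>" using \<alpha> by (auto simp: \<theta>_def field_simps)
  have "\<forall>\<^sub>F n in sequentially. real n powr (- \<theta>) \<le> 1 / 2" using \<theta>(1) by real_asymp
  then have half: "\<forall>\<^sub>F n in sequentially. p n \<le> 1 / 2"
    using density_exponent_p_le[OF dens \<theta>(1)] unfolding \<theta>(2) by eventually_elim simp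
  have k: "\<forall>\<^sub>F n in sequentially. c / 2 * (ln (real n) / p n) \<le> real (k n) \<and>
      real (k n) \<le> c * (ln (real n) / p n)"
    using density_exponent_pos[OF dens] eventually_ge_at_top[of 3]
      eventually_compose_filterlim[OF eventually_ge_at_top[of "2 / c"]
        filterlim_compose[OF ln_at_top filterlim_real_sequentially]]
  proof eventually_elim
    case (elim n)
    have "2 / c \<le> ln (real n) / p n"
    proof -
      have "ln (real n) / 1 \<le> ln (real n) / p n"
        using elim p[of n] ln_ge_one[OF elim(2)] by (intro divide_left_mono) auto
      then show ?thesis using elim(3) by simp
    qed
    then have "2 \<le> c * (ln (real n) / p n)" using c0 by (simp add: field_simps)
    moreover have "y / 2 \<le> real (nat \<lfloor>y\<rfloor>)" "real (nat \<lfloor>y\<rfloor>) \<le> y" if "2 \<le> y" for y :: real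
      using that by linarith+
    ultimately show ?case unfolding k_def by (metis times_divide_eq_left)
  qed
  have "aas p (\<lambda>n E. real (k n) \<le> cL n E)"
  proof (rule aas_lower_dense[OF p, where \<gamma> = "2 * c" and \<rho> = "4 * c"])
    show "\<forall>\<^sub>F n in sequentially. 0 < p n" by (rule density_exponent_pos[OF dens])
    show "\<forall>\<^sub>F n in sequentially. real (k n) \<le> ln (real n) / p n"
      using k density_exponent_pos[OF dens] eventually_ge_at_top[of 3]
    proof eventually_elim
      case (elim n)
      have "c * (ln (real n) / p n) \<le> 1 * (ln (real n) / p n)"
        using elim ln_ge_one[OF elim(3)] c1 by (intro mult_right_mono) auto
      then show ?case using elim by simp
    qed
    show "\<forall>\<^sub>F n in sequentially. real n powr - (2 * c) \<le> (1 - p n) ^ k n"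
      using k density_exponent_pos[OF dens] half eventually_ge_at_top[of 3]
    proof eventually_elim
      case (elim n)
      \<comment> \<open>For p \<le> 1/2 one has ln (1 - p) \<ge> - 2 p, and k p \<le> c ln n then
        gives (1 - p)^k \<ge> n^(- 2c).\<close>
      have "p n * p n \<le> p n * (1 / 2)" using elim by (intro mult_left_mono) auto
      then have "- (2 * p n) \<le> - p n - 2 * (p n)\<^sup>2" by (simp add: power2_eq_square)
      also have "\<dots> \<le> ln (1 - p n)" using elim by (intro ln_one_minus_pos_lower_bound) auto
      finally have "exp (- (2 * p n)) \<le> 1 - p n" using elim by (simp add: ln_ge_iff)
      then have "exp (- (2 * p n)) ^ k n \<le> (1 - p n) ^ k n" by (intro power_mono) auto
      moreover have "exp (- (2 * p n)) ^ k n = exp (- (2 * (real (k n) * p n)))"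
        by (simp add: exp_of_nat_mult[symmetric] mult_ac)
      moreover have "real (k n) * p n \<le> c * ln (real n)"
        using elim by (simp add: field_simps)
      then have "real n powr - (2 * c) \<le> exp (- (2 * (real (k n) * p n)))"
        using elim(4) by (simp add: powr_def)
      ultimately show ?case by linarith
    qed
    show "\<forall>\<^sub>F n in sequentially. real n powr (4 * c) \<le> (p n)\<^sup>2 * real n powr (1 - 2 * c)"
      using density_exponent_p_ge[OF dens c0] eventually_ge_at_top[of 3]
    proof eventually_elim
      case (elim n)
      have "real n powr (4 * c) = (real n powr (\<alpha> - 1 - c))\<^sup>2 * real n powr (1 - 2 * c)"
        using elim(2) by (simp add: powr_power powr_add[symmetric]) (simp add: c_def field_simps)
      also have "\<dots> \<le> (p n)\<^sup>2 * real n powr (1 - 2 * c)"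
        using elim by (intro mult_right_mono power_mono) auto
      finally show ?case .
    qed
  qed (use c0 in auto)
  then have "aas p (\<lambda>n E. c / 2 * (ln (real n) / p n) \<le> cL n E)"
    by (rule aas_mono) (use k in \<open>auto elim!: eventually_mono\<close>)
  then show ?thesis using c0 by (intro exI[of _ "c / 2"]) auto
qed

section \<open>The logarithmic regime\<close>

lemma log_inverse_one_minus:
  assumes "p < 1"
  shows "log (1 / (1 - p)) x = ln x / (- ln (1 - p))"
  using assms by (simp add: log_def ln_div)

lemma log_inverse_one_minus_nonneg:
  assumes "0 \<le> p" "p \<le> 1"
  shows "0 \<le> log (1 / (1 - p)) (real n)"
proof (cases "p = 1 \<or> n = 0")
  \<comment> \<open>The default values of division by 0 and of \<open>ln 0\<close> make the
    logarithm 0 here.\<close>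
  case True then show ?thesis by (auto simp: log_def)
next
  case False
  then have "0 \<le> - ln (1 - p)" "0 \<le> ln (real n)" using assms by auto
  then have "0 \<le> ln (real n) / (- ln (1 - p))" by (rule divide_nonneg_nonneg[rotated])
  then show ?thesis using False assms by (simp add: log_inverse_one_minus)
qed

lemma log_inverse_one_minus_asymp:
  assumes "p \<longlonglongrightarrow> 0" "\<forall>\<^sub>F n in sequentially. 0 < p n"
  shows "(\<lambda>n. log (1 / (1 - p n)) (real n)) \<sim>[sequentially] (\<lambda>n. ln (real n) / p n)"
proof (rule asymp_equivI')
  have "filterlim p (at_right 0) sequentially"
    using assms by (auto simp: filterlim_at elim: eventually_mono)
  moreover have "((\<lambda>x::real. x / (- ln (1 - x))) \<longlongrightarrow> 1) (at_right 0)" by real_asymp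
  ultimately have lim: "(\<lambda>n. p n / (- ln (1 - p n))) \<longlonglongrightarrow> 1" by (rule filterlim_compose[rotated])
  have "\<forall>\<^sub>F n in sequentially. p n < 1" using order_tendstoD(2)[OF assms(1), of 1] by simp
  then have "\<forall>\<^sub>F n in sequentially. log (1 / (1 - p n)) (real n) / (ln (real n) / p n) = p n / (- ln (1 - p n))"
    using assms(2) eventually_ge_at_top[of 3]
  proof eventually_elim
    case (elim n)
    have "ln (real n) \<noteq> 0" using ln_ge_one[OF elim(3)] by simp
    then show ?case using elim by (simp add: log_inverse_one_minus)
  qed
  then show "(\<lambda>n. log (1 / (1 - p n)) (real n) / (ln (real n) / p n)) \<longlonglongrightarrow> 1"
    using lim by (subst tendsto_cong)
qed

text \<open>p < 1 - \<epsilon> keeps the base of the logarithm bounded by 1 / \<epsilon>, so its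
  value tends to infinity; this absorbs the rounding of the number of cops.\<close>

lemma eventually_log_inverse_one_minus_ge:
  assumes p: "\<And>n. 0 \<le> p n" "\<forall>\<^sub>F n in sequentially. 0 < p n" and \<epsilon>: "\<forall>\<^sub>F n in sequentially. p n < 1 - \<epsilon>" "0 < \<epsilon>"
  shows "\<forall>\<^sub>F n in sequentially. C \<le> log (1 / (1 - p n)) (real n)"
proof -
  have "\<forall>\<^sub>F n in sequentially. \<bar>C\<bar> * (- ln \<epsilon>) \<le> ln (real n)" by real_asymp
  then show ?thesis using p(2) \<epsilon>(1)
  proof eventually_elim
    case (elim n)
    have "ln \<epsilon> \<le> ln (1 - p n)" using elim \<epsilon>(2) by (intro ln_mono) auto
    moreover have pos: "0 < - ln (1 - p n)" using elim \<epsilon>(2) by simp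
    ultimately have "\<bar>C\<bar> * (- ln (1 - p n)) \<le> \<bar>C\<bar> * (- ln \<epsilon>)" by (intro mult_left_mono) auto
    also have "\<dots> \<le> ln (real n)" by (rule elim(1))
    finally have "\<bar>C\<bar> \<le> ln (real n) / (- ln (1 - p n))" using pos by (simp only: pos_le_divide_eq)
    then show ?case using elim \<epsilon>(2) by (simp add: log_inverse_one_minus)
  qed
qed

lemma one_minus_power_eq:
  assumes "p < (1::real)"
  shows "(1 - p) ^ k = exp (- (real k * - ln (1 - p)))"
  using assms by (simp add: exp_of_nat_mult)

lemma log_inverse_one_minus_le:
  assumes "0 < p" "p < 1" "1 \<le> n"
  shows "log (1 / (1 - p)) (real n) \<le> ln (real n) / p"
proof -
  have "p \<le> - ln (1 - p)" using ln_le_minus_one[of "1 - p"] assms by simp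
  then show ?thesis
    unfolding log_inverse_one_minus[OF assms(2)] using assms by (intro frac_le) auto
qed

lemma aas_cL_log_upper:
  assumes p: "\<And>n. 0 \<le> p n \<and> p n \<le> 1" and dens: "density_exponent \<alpha> p" "0 < \<alpha>"
    and \<epsilon>: "0 < \<epsilon>" "\<forall>\<^sub>F n in sequentially. p n < 1 - \<epsilon>" and \<delta>: "0 < \<delta>"
  shows "aas p (\<lambda>n E. cL n E \<le> (1 + \<delta>) * log (1 / (1 - p n)) (real n))"
proof -
  \<comment> \<open>Half of \<delta> makes \<open>n * (1 - p) ^ k\<close> at most n^(- \<delta>/2);
    the other half pays for rounding up.\<close>
  define k where "k n = nat \<lceil>(1 + \<delta> / 2) * log (1 / (1 - p n)) (real n)\<rceil>" for n
  note pos = density_exponent_pos[OF dens(1)]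
  have ev: "\<forall>\<^sub>F n in sequentially. real (k n) \<le> (1 + \<delta>) * log (1 / (1 - p n)) (real n) \<and>
      k n \<le> n \<and> real n * (1 - p n) ^ k n \<le> real n powr (- (\<delta> / 2))"
    using pos \<epsilon>(2) eventually_log_inverse_one_minus_ge[OF conjunct1[OF p] pos \<epsilon>(2,1), of "2 / \<delta>"]
      density_exponent_ln_le[OF dens, of "1 + \<delta>"] eventually_ge_at_top[of 3]
  proof eventually_elim
    case (elim n)
    define \<beta> where "\<beta> = log (1 / (1 - p n)) (real n)"
    have p1: "p n < 1" using elim \<epsilon>(1) by simp
    have \<beta>: "2 / \<delta> \<le> \<beta>" using elim by (simp add: \<beta>_def)
    have \<beta>0: "0 \<le> \<beta>" using \<beta> \<delta> by (meson divide_nonneg_pos order_trans zero_le_numeral)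
    have \<beta>1: "1 \<le> \<delta> / 2 * \<beta>" using \<beta> \<delta> by (simp add: field_simps)
    have k_ge: "(1 + \<delta> / 2) * \<beta> \<le> real (k n)" unfolding k_def \<beta>_def[symmetric] by linarith
    have "0 \<le> (1 + \<delta> / 2) * \<beta>" using \<beta>0 \<delta> by simp
    then have "real (k n) \<le> (1 + \<delta> / 2) * \<beta> + 1" unfolding k_def \<beta>_def[symmetric] by linarith
    also have "\<dots> \<le> (1 + \<delta> / 2) * \<beta> + \<delta> / 2 * \<beta>" using \<beta>1 by simp
    also have "\<dots> = (1 + \<delta>) * \<beta>" by (simp add: algebra_simps)
    finally have 1: "real (k n) \<le> (1 + \<delta>) * \<beta>" .
    also have "\<dots> \<le> (1 + \<delta>) * (ln (real n) / p n)"
      unfolding \<beta>_def using log_inverse_one_minus_le[OF elim(1) p1, of n] elim \<delta> by (intro mult_left_mono) auto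
    also have "\<dots> \<le> real n" using elim by (simp add: field_simps)
    finally have 2: "k n \<le> n" by simp
    have L: "0 < - ln (1 - p n)" using elim p1 by simp
    have "(1 + \<delta> / 2) * ln (real n) = (1 + \<delta> / 2) * \<beta> * - ln (1 - p n)"
      using L by (simp add: \<beta>_def log_inverse_one_minus[OF p1])
    also have "\<dots> \<le> real (k n) * - ln (1 - p n)" using k_ge L by (intro mult_right_mono) auto
    finally have "(1 - p n) ^ k n \<le> exp (- ((1 + \<delta> / 2) * ln (real n)))"
      unfolding one_minus_power_eq[OF p1] by simp
    also have "\<dots> = real n powr (- (1 + \<delta> / 2))" using elim(5) by (simp add: powr_def algebra_simps)
    finally have "real n * (1 - p n) ^ k n \<le> real n * real n powr (- (1 + \<delta> / 2))"
      by (intro mult_left_mono) auto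
    also have "\<dots> = real n powr (- (\<delta> / 2))" using elim(5) by (simp add: powr_mult_base)
    finally show ?case using 1 2 by (simp add: \<beta>_def)
  qed
  have "aas p (\<lambda>n E. cL n E \<le> real (k n))"
  proof (rule aas_upper[OF p])
    show "(\<lambda>n. real n powr (- (\<delta> / 2))) \<longlonglongrightarrow> 0" using \<delta> by real_asymp
  qed (use ev in \<open>auto elim: eventually_mono\<close>)
  then show ?thesis by (rule aas_mono) (use ev in \<open>auto elim!: eventually_mono\<close>)
qed

lemma aas_cL_log_lower:
  assumes p: "\<And>n. 0 \<le> p n \<and> p n \<le> 1" and dens: "density_exponent 1 p"
    and \<epsilon>: "0 < \<epsilon>" "\<forall>\<^sub>F n in sequentially. p n < 1 - \<epsilon>" and \<delta>: "0 < \<delta>" "\<delta> < 1"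
  shows "aas p (\<lambda>n E. (1 - 2 * \<delta>) * log (1 / (1 - p n)) (real n) \<le> cL n E)"
proof -
  \<comment> \<open>One \<delta> keeps (1 - p)^k at least n^(-(1 - \<delta>)); the second one in the
    conclusion pays for rounding down.\<close>
  define k where "k n = nat \<lfloor>(1 - \<delta>) * log (1 / (1 - p n)) (real n)\<rfloor>" for n
  note pos = density_exponent_pos[OF dens(1)]
  have ev: "\<forall>\<^sub>F n in sequentially. (1 - 2 * \<delta>) * log (1 / (1 - p n)) (real n) \<le> real (k n) \<and>
      real (k n) \<le> ln (real n) / p n \<and> real n powr - (1 - \<delta>) \<le> (1 - p n) ^ k n"
    using pos \<epsilon>(2) eventually_log_inverse_one_minus_ge[OF conjunct1[OF p] pos \<epsilon>(2,1), of "1 / \<delta>"]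
      eventually_ge_at_top[of 3]
  proof eventually_elim
    case (elim n)
    define \<beta> where "\<beta> = log (1 / (1 - p n)) (real n)"
    have p1: "p n < 1" using elim \<epsilon>(1) by simp
    have \<beta>: "1 / \<delta> \<le> \<beta>" using elim by (simp add: \<beta>_def)
    have \<beta>0: "0 \<le> \<beta>" using \<beta> \<delta> by (meson divide_nonneg_pos order_trans zero_le_one)
    have \<beta>1: "1 \<le> \<delta> * \<beta>" using \<beta> \<delta> by (simp add: field_simps)
    have "(1 - 2 * \<delta>) * \<beta> = (1 - \<delta>) * \<beta> - \<delta> * \<beta>" by (simp add: algebra_simps)
    also have "\<dots> \<le> (1 - \<delta>) * \<beta> - 1" using \<beta>1 by simp
    also have "\<dots> \<le> real (k n)" unfolding k_def \<beta>_def[symmetric] by linarith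
    finally have 1: "(1 - 2 * \<delta>) * \<beta> \<le> real (k n)" .
    have "0 \<le> (1 - \<delta>) * \<beta>" using \<beta>0 \<delta> by simp
    then have k_le: "real (k n) \<le> (1 - \<delta>) * \<beta>" unfolding k_def \<beta>_def[symmetric] by linarith
    also have "\<dots> \<le> 1 * \<beta>" using \<beta>0 \<delta> by (intro mult_right_mono) auto
    also have "\<dots> \<le> ln (real n) / p n"
      using log_inverse_one_minus_le[OF elim(1) p1, of n] elim by (simp add: \<beta>_def)
    finally have 2: "real (k n) \<le> ln (real n) / p n" .
    have L: "0 < - ln (1 - p n)" using elim p1 by simp
    have "real (k n) * - ln (1 - p n) \<le> (1 - \<delta>) * \<beta> * - ln (1 - p n)"
      using k_le L by (intro mult_right_mono) auto
    also have "\<dots> = (1 - \<delta>) * ln (real n)" using L by (simp add: \<beta>_def log_inverse_one_minus[OF p1])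
    finally have "exp (- ((1 - \<delta>) * ln (real n))) \<le> (1 - p n) ^ k n"
      unfolding one_minus_power_eq[OF p1] by simp
    moreover have "exp (- ((1 - \<delta>) * ln (real n))) = real n powr - (1 - \<delta>)"
      using elim(4) by (simp add: powr_def algebra_simps)
    ultimately show ?case using 1 2 by (simp add: \<beta>_def)
  qed
  have \<delta>4: "0 < \<delta> / 4" using \<delta> by simp
  have "aas p (\<lambda>n E. real (k n) \<le> cL n E)"
  \<comment> \<open>With 1 - \<gamma> = \<delta>, the bound p \<ge> n^(- \<delta>/4) gives p^2
    n^\<delta> \<ge> n^(\<delta>/2).\<close>
  proof (rule aas_lower_dense[OF p, where \<gamma> = "1 - \<delta>" and \<rho> = "\<delta> / 2"])
    show "\<forall>\<^sub>F n in sequentially. real n powr (\<delta> / 2) \<le> (p n)\<^sup>2 * real n powr (1 - (1 - \<delta>))"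
      using density_exponent_p_ge[OF dens \<delta>4] eventually_ge_at_top[of 3]
    proof eventually_elim
      case (elim n)
      have "real n powr (\<delta> / 2) = (real n powr (1 - 1 - \<delta> / 4))\<^sup>2 * real n powr (1 - (1 - \<delta>))"
        using elim(2) by (simp add: powr_power powr_add[symmetric])
      also have "\<dots> \<le> (p n)\<^sup>2 * real n powr (1 - (1 - \<delta>))"
        using elim by (intro mult_right_mono power_mono) auto
      finally show ?case .
    qed
  qed (use ev pos \<delta> in \<open>auto elim: eventually_mono\<close>)
  then show ?thesis by (rule aas_mono) (use ev in \<open>auto elim!: eventually_mono\<close>)
qed

lemma aas_cL_log:
  assumes p: "\<And>n. 0 \<le> p n \<and> p n \<le> 1" and dens: "density_exponent 1 p"
    and \<epsilon>: "0 < \<epsilon>" "\<forall>\<^sub>F n in sequentially. p n < 1 - \<epsilon>" and \<delta>: "0 < \<delta>"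
  shows "aas p (\<lambda>n E. \<bar>cL n E - log (1 / (1 - p n)) (real n)\<bar> \<le> \<delta> * log (1 / (1 - p n)) (real n))"
proof -
  define \<theta> where "\<theta> = min \<delta> 1 / 4"
  have \<theta>: "0 < \<theta>" "\<theta> < 1" "2 * \<theta> \<le> \<delta>" using \<delta> by (auto simp: \<theta>_def min_def)
  show ?thesis
  proof (rule aas_mono[OF aas_conj[OF aas_cL_log_upper[OF p dens _ \<epsilon> \<delta>] aas_cL_log_lower[OF p dens \<epsilon> \<theta>(1,2)]]])
    show "\<forall>\<^sub>F n in sequentially. \<forall>E. cL n E \<le> (1 + \<delta>) * log (1 / (1 - p n)) (real n) \<and>
        (1 - 2 * \<theta>) * log (1 / (1 - p n)) (real n) \<le> cL n E \<longrightarrow>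
        \<bar>cL n E - log (1 / (1 - p n)) (real n)\<bar> \<le> \<delta> * log (1 / (1 - p n)) (real n)"
    proof (intro always_eventually allI impI)
      fix n E
      define \<beta> where "\<beta> = log (1 / (1 - p n)) (real n)"
      have "2 * \<theta> * \<beta> \<le> \<delta> * \<beta>"
        unfolding \<beta>_def using \<theta>(3) log_inverse_one_minus_nonneg[of "p n" n] p by (intro mult_right_mono) auto
      moreover assume "cL n E \<le> (1 + \<delta>) * log (1 / (1 - p n)) (real n) \<and>
        (1 - 2 * \<theta>) * log (1 / (1 - p n)) (real n) \<le> cL n E"
      then have "cL n E \<le> \<beta> + \<delta> * \<beta>" "\<beta> - 2 * \<theta> * \<beta> \<le> cL n E"
        unfolding \<beta>_def by (auto simp: algebra_simps)
      ultimately have "\<bar>cL n E - \<beta>\<bar> \<le> \<delta> * \<beta>" by linarith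
      then show "\<bar>cL n E - log (1 / (1 - p n)) (real n)\<bar> \<le> \<delta> * log (1 / (1 - p n)) (real n)"
        by (simp add: \<beta>_def)
    qed
  qed simp
qed

section \<open>The exponent of the lazy cop number and the final assembly\<close>

lemma aas_cL_exponent:
  assumes p: "\<And>n. 0 \<le> p n \<and> p n \<le> 1" and dens: "density_exponent \<alpha> p" "0 < \<alpha>"
    and lower: "\<And>\<delta>. 0 < \<delta> \<Longrightarrow> aas p (\<lambda>n E. real n powr (1 - \<alpha> - \<delta>) \<le> cL n E)"
  shows "\<exists>\<delta>::nat \<Rightarrow> real. \<delta> \<longlonglongrightarrow> 0 \<and> aas p (\<lambda>n E. real n powr (1 - \<alpha> - \<delta> n) \<le> cL n E \<and>
    cL n E \<le> real n powr (1 - \<alpha> + \<delta> n))"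
proof (rule aas_diagonal)
  fix n E and \<delta> \<delta>' :: real
  assume *: "real n powr (1 - \<alpha> - \<delta>) \<le> cL n E \<and> cL n E \<le> real n powr (1 - \<alpha> + \<delta>)" "\<delta> \<le> \<delta>'"
  have mono: "real n powr a \<le> real n powr b" if "a \<le> b" for a b
    using that by (cases "n = 0") (auto intro: powr_mono)
  show "real n powr (1 - \<alpha> - \<delta>') \<le> cL n E \<and> cL n E \<le> real n powr (1 - \<alpha> + \<delta>')"
    using * mono[of "1 - \<alpha> - \<delta>'" "1 - \<alpha> - \<delta>"] mono[of "1 - \<alpha> + \<delta>" "1 - \<alpha> + \<delta>'"] by auto
next
  fix \<delta> :: real assume \<delta>: "0 < \<delta>"
  have "aas p (\<lambda>n E. cL n E \<le> real n powr (1 - \<alpha> + \<delta>))"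
  proof (rule aas_mono[OF aas_cL_le_ln_div_p[OF p dens]])
    have "\<forall>\<^sub>F n in sequentially. 3 * ln (real n) \<le> real n powr (\<delta> / 2)" using \<delta> by real_asymp
    then show "\<forall>\<^sub>F n in sequentially. \<forall>E. cL n E \<le> 3 * (ln (real n) / p n) \<longrightarrow> cL n E \<le> real n powr (1 - \<alpha> + \<delta>)"
      using density_exponent_p_ge[OF dens(1) half_gt_zero[OF \<delta>]] density_exponent_pos[OF dens(1)]
        eventually_ge_at_top[of 3]
    proof eventually_elim
      case (elim n)
      have "3 * (ln (real n) / p n) = 3 * ln (real n) / p n" by simp
      also have "\<dots> \<le> real n powr (\<delta> / 2) / real n powr (\<alpha> - 1 - \<delta> / 2)"
        using elim by (intro frac_le) auto
      also have "\<dots> = real n powr (1 - \<alpha> + \<delta>)"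
        by (simp add: powr_diff[symmetric]) (simp add: algebra_simps)
      finally show ?case by auto
    qed
  qed
  then show "aas p (\<lambda>n E. real n powr (1 - \<alpha> - \<delta>) \<le> cL n E \<and> cL n E \<le> real n powr (1 - \<alpha> + \<delta>))"
    by (rule aas_conj[OF lower[OF \<delta>]])
qed

text \<open>Stated for the weakest of the sparse lower bounds; those of order 1 / p and ln n / p are
  first weakened to it. The squared logarithm disappears in half of the exponent \<delta>.\<close>

lemma aas_powr_lower:
  assumes dens: "density_exponent \<alpha> p" and c: "0 < c" "0 < \<delta>"
    and lower: "aas p (\<lambda>n E. c / (p n * (ln (real n))\<^sup>2) \<le> cL n E)"
  shows "aas p (\<lambda>n E. real n powr (1 - \<alpha> - \<delta>) \<le> cL n E)"
proof (rule aas_mono[OF lower])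
  have "\<forall>\<^sub>F n in sequentially. (ln (real n))\<^sup>2 / c \<le> real n powr (\<delta> / 2)" using c by real_asymp
  then show "\<forall>\<^sub>F n in sequentially. \<forall>E. c / (p n * (ln (real n))\<^sup>2) \<le> cL n E \<longrightarrow>
      real n powr (1 - \<alpha> - \<delta>) \<le> cL n E"
    using density_exponent_p_le[OF dens half_gt_zero[OF c(2)]] density_exponent_pos[OF dens]
      eventually_ge_at_top[of 3]
  proof eventually_elim
    case (elim n)
    have ln0: "0 < (ln (real n))\<^sup>2" using ln_ge_one[OF elim(4)] by simp
    have "p n * ((ln (real n))\<^sup>2 / c) \<le> real n powr (\<alpha> - 1 + \<delta> / 2) * real n powr (\<delta> / 2)"
      using elim c by (intro mult_mono) auto
    also have "\<dots> = real n powr (\<alpha> - 1 + \<delta>)" by (simp add: powr_add[symmetric] add.commute)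
    finally have "p n * (ln (real n))\<^sup>2 / c \<le> real n powr (\<alpha> - 1 + \<delta>)" by simp
    then have "1 / real n powr (\<alpha> - 1 + \<delta>) \<le> 1 / (p n * (ln (real n))\<^sup>2 / c)"
      using elim ln0 c by (intro divide_left_mono) auto
    moreover have "1 / real n powr (\<alpha> - 1 + \<delta>) = real n powr (1 - \<alpha> - \<delta>)"
      by (simp add: powr_minus_divide[symmetric] algebra_simps)
    ultimately show ?case by auto
  qed
qed

theorem theorem2p1:
  fixes \<alpha> \<epsilon> :: real and p :: "nat \<Rightarrow> real"
  assumes "0 < \<alpha>" "\<alpha> \<le> 1" "0 < \<epsilon>"
    and "\<And>n. 0 \<le> p n \<and> p n \<le> 1"
    and "\<exists>\<delta>::nat \<Rightarrow> real. \<delta> \<longlonglongrightarrow> 0 \<and>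
           (\<forall>\<^sub>F n in sequentially. (real n - 1) * p n = real n powr (\<alpha> + \<delta> n))"
  shows
    "(\<alpha> = 1 \<and> (\<forall>\<^sub>F n in sequentially. p n < 1 - \<epsilon>) \<longrightarrow>
        (\<exists>\<delta>::nat \<Rightarrow> real. \<delta> \<longlonglongrightarrow> 0 \<and>
           aas p (\<lambda>n E. \<bar>cL n E - log (1 / (1 - p n)) (real n)\<bar>
                          \<le> \<delta> n * log (1 / (1 - p n)) (real n))))
     \<and> (p \<longlonglongrightarrow> 0 \<longrightarrow>
          (\<lambda>n. log (1 / (1 - p n)) (real n)) \<sim>[sequentially] (\<lambda>n. ln (real n) / p n))
     \<and> (1/2 < \<alpha> \<and> \<alpha> < 1 \<longrightarrow>
        (\<exists>c>0. \<exists>C>0. aas p (\<lambda>n E. c * (ln (real n) / p n) \<le> cL n E \<and>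
                                      cL n E \<le> C * (ln (real n) / p n))))
     \<and> (\<forall>j::nat. 2 \<le> j \<and> 1 / (real j + 1) < \<alpha> \<and> \<alpha> < 1 / real j \<longrightarrow>
        (\<exists>C>0. aas p (\<lambda>n E. 1 / p n \<le> C * cL n E)) \<and>
        (\<exists>C>0. aas p (\<lambda>n E. cL n E \<le> C * (ln (real n) / p n))))
     \<and> (\<forall>j::nat. 2 \<le> j \<and> \<alpha> = 1 / real j \<longrightarrow>
        (\<exists>C>0. aas p (\<lambda>n E. 1 / (p n * (ln (real n))\<^sup>2) \<le> C * cL n E)) \<and>
        (\<exists>C>0. aas p (\<lambda>n E. cL n E \<le> C * (ln (real n) / p n))))
     \<and> ((\<alpha> = 1 \<and> (\<forall>\<^sub>F n in sequentially. p n < 1 - \<epsilon>))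
         \<or> (1/2 < \<alpha> \<and> \<alpha> < 1)
         \<or> (\<exists>j::nat. 2 \<le> j \<and> 1 / (real j + 1) < \<alpha> \<and> \<alpha> < 1 / real j)
         \<or> (\<exists>j::nat. 2 \<le> j \<and> \<alpha> = 1 / real j) \<longrightarrow>
        (\<exists>\<delta>::nat \<Rightarrow> real. \<delta> \<longlonglongrightarrow> 0 \<and>
           aas p (\<lambda>n E. real n powr (1 - \<alpha> - \<delta> n) \<le> cL n E \<and>
                         cL n E \<le> real n powr (1 - \<alpha> + \<delta> n))))"
proof -
  note \<alpha> = assms(1,2) and \<epsilon> = assms(3) and p = assms(4)
  obtain \<delta>0 :: "nat \<Rightarrow> real" where \<delta>0: "\<delta>0 \<longlonglongrightarrow> 0"
    "\<forall>\<^sub>F n in sequentially. (real n - 1) * p n = real n powr (\<alpha> + \<delta>0 n)"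
    using assms(5) by blast
  have dens: "density_exponent \<alpha> p"
    using density_exponentI[OF \<delta>0(1) _ \<delta>0(2)] p by blast
  note pos = density_exponent_pos[OF dens]
  have upper: "aas p (\<lambda>n E. cL n E \<le> 3 * (ln (real n) / p n))"
    by (rule aas_cL_le_ln_div_p[OF p dens \<alpha>(1)])
  then have upper_ex: "\<exists>C>0. aas p (\<lambda>n E. cL n E \<le> C * (ln (real n) / p n))"
    by (intro exI[of _ 3]) auto
  have i: "\<exists>\<delta>::nat \<Rightarrow> real. \<delta> \<longlonglongrightarrow> 0 \<and>
      aas p (\<lambda>n E. \<bar>cL n E - log (1 / (1 - p n)) (real n)\<bar> \<le> \<delta> n * log (1 / (1 - p n)) (real n))"
    if "\<alpha> = 1" "\<forall>\<^sub>F n in sequentially. p n < 1 - \<epsilon>"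
  proof (rule aas_diagonal)
    fix n E and d d' :: real
    assume "\<bar>cL n E - log (1 / (1 - p n)) (real n)\<bar> \<le> d * log (1 / (1 - p n)) (real n)" "d \<le> d'"
    moreover from this(2) have "d * log (1 / (1 - p n)) (real n) \<le> d' * log (1 / (1 - p n)) (real n)"
      using log_inverse_one_minus_nonneg[of "p n" n] p by (intro mult_right_mono) auto
    ultimately show "\<bar>cL n E - log (1 / (1 - p n)) (real n)\<bar> \<le> d' * log (1 / (1 - p n)) (real n)"
      by linarith
  next
    fix d :: real assume "0 < d"
    then show "aas p (\<lambda>n E. \<bar>cL n E - log (1 / (1 - p n)) (real n)\<bar> \<le> d * log (1 / (1 - p n)) (real n))"
      by (rule aas_cL_log[OF p dens[unfolded that(1)] \<epsilon> that(2)])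
  qed
  have ii: "\<exists>c>0. aas p (\<lambda>n E. c * (ln (real n) / p n) \<le> cL n E)" if "1 / 2 < \<alpha>" "\<alpha> < 1"
    by (rule aas_lower_ln_div_p[OF p dens that])
  have iii: "\<exists>c>0. aas p (\<lambda>n E. c / p n \<le> cL n E)"
    if "2 \<le> j" "1 / (real j + 1) < \<alpha>" "\<alpha> < 1 / real j" for j :: nat
  proof (rule aas_lower_noncritical[OF p dens \<alpha>(1)])
    show "1 \<le> j" using that by simp
    show "real j * \<alpha> < 1" using that by (simp add: pos_less_divide_eq mult.commute)
    show "1 < (real j + 1) * \<alpha>" using that by (simp add: pos_divide_less_eq mult.commute)
  qed
  have iv: "\<exists>c>0. aas p (\<lambda>n E. c / (p n * (ln (real n))\<^sup>2) \<le> cL n E)"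
    if "2 \<le> j" "\<alpha> = 1 / real j" for j :: nat
    by (rule aas_lower_critical[OF p dens that])
  have from_iii: "aas p (\<lambda>n E. c / (p n * (ln (real n))\<^sup>2) \<le> cL n E)"
    if "0 < c" "aas p (\<lambda>n E. c / p n \<le> cL n E)" for c
  proof (rule aas_mono[OF that(2)])
    show "\<forall>\<^sub>F n in sequentially. \<forall>E. c / p n \<le> cL n E \<longrightarrow> c / (p n * (ln (real n))\<^sup>2) \<le> cL n E"
      using pos eventually_ge_at_top[of 3]
    proof eventually_elim
      case (elim n)
      have "p n * 1 \<le> p n * (ln (real n))\<^sup>2"
        using elim ln_ge_one[OF elim(2)] by (intro mult_left_mono) auto
      then have "c / (p n * (ln (real n))\<^sup>2) \<le> c / p n"
        using elim(1) that(1) by (intro frac_le) auto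
      then show ?case by auto
    qed
  qed
  have exponent: "aas p (\<lambda>n E. real n powr (1 - \<alpha> - \<delta>) \<le> cL n E)"
    if cases: "\<alpha> = 1 \<and> (\<forall>\<^sub>F n in sequentially. p n < 1 - \<epsilon>) \<or> 1 / 2 < \<alpha> \<and> \<alpha> < 1 \<or>
      (\<exists>j::nat. 2 \<le> j \<and> 1 / (real j + 1) < \<alpha> \<and> \<alpha> < 1 / real j) \<or> (\<exists>j::nat. 2 \<le> j \<and> \<alpha> = 1 / real j)"
      and \<delta>: "0 < \<delta>" for \<delta>
    using cases
  proof (elim disjE conjE exE)
    assume "\<alpha> = 1" and lt: "\<forall>\<^sub>F n in sequentially. p n < 1 - \<epsilon>"
    note dens1 = dens[unfolded \<open>\<alpha> = 1\<close>]
    \<comment> \<open>For \<alpha> = 1 the target n^(- \<delta>) is at most 1, so half of a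
      logarithm that is eventually at least 2 is enough.\<close>
    have "aas p (\<lambda>n E. (1 - 2 * (1 / 4)) * log (1 / (1 - p n)) (real n) \<le> cL n E)"
      by (rule aas_cL_log_lower[OF p dens1 \<epsilon> lt]) auto
    then show ?thesis
    proof (rule aas_mono)
      show "\<forall>\<^sub>F n in sequentially. \<forall>E. (1 - 2 * (1 / 4)) * log (1 / (1 - p n)) (real n) \<le> cL n E \<longrightarrow>
          real n powr (1 - \<alpha> - \<delta>) \<le> cL n E"
        using eventually_log_inverse_one_minus_ge[OF conjunct1[OF p] pos lt \<epsilon>, of 2] eventually_ge_at_top[of 3]
      proof eventually_elim
        case (elim n)
        have "real n powr (1 - \<alpha> - \<delta>) \<le> real n powr 0"
          using elim(2) \<delta> \<open>\<alpha> = 1\<close> by (intro powr_mono) auto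
        then show ?case using elim by auto
      qed
    qed
  next
    assume "1 / 2 < \<alpha>" "\<alpha> < 1"
    from ii[OF this] obtain c where c: "0 < c" "aas p (\<lambda>n E. c * (ln (real n) / p n) \<le> cL n E)" by blast
    have "aas p (\<lambda>n E. c / p n \<le> cL n E)"
    proof (rule aas_mono[OF c(2)])
      show "\<forall>\<^sub>F n in sequentially. \<forall>E. c * (ln (real n) / p n) \<le> cL n E \<longrightarrow> c / p n \<le> cL n E"
        using pos eventually_ge_at_top[of 3]
      proof eventually_elim
        case (elim n)
        have "c * (1 / p n) \<le> c * (ln (real n) / p n)"
          using elim(1) ln_ge_one[OF elim(2)] c(1) by (intro mult_left_mono divide_right_mono) auto
        then show ?case by auto
      qed
    qed
    from aas_powr_lower[OF dens c(1) \<delta> from_iii[OF c(1) this]] show ?thesis .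
  next
    fix j :: nat assume "2 \<le> j" "1 / (real j + 1) < \<alpha>" "\<alpha> < 1 / real j"
    from iii[OF this] obtain c where c: "0 < c" "aas p (\<lambda>n E. c / p n \<le> cL n E)" by blast
    from aas_powr_lower[OF dens c(1) \<delta> from_iii[OF c]] show ?thesis .
  next
    fix j :: nat assume "2 \<le> j" "\<alpha> = 1 / real j"
    from iv[OF this] obtain c where c: "0 < c" "aas p (\<lambda>n E. c / (p n * (ln (real n))\<^sup>2) \<le> cL n E)" by blast
    from aas_powr_lower[OF dens c(1) \<delta> c(2)] show ?thesis .
  qed
  have scale: "\<exists>C>0. aas p (\<lambda>n E. 1 / f n \<le> C * cL n E)"
    if ex: "\<exists>c>0. aas p (\<lambda>n E. c / f n \<le> cL n E)" for f :: "nat \<Rightarrow> real"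
  proof -
    obtain c where c: "0 < c" "aas p (\<lambda>n E. c / f n \<le> cL n E)" using ex by blast
    have "1 / f n \<le> 1 / c * cL n E" if "c / f n \<le> cL n E" for n E
      using mult_left_mono[OF that, of "1 / c"] c(1) by simp
    then have "aas p (\<lambda>n E. 1 / f n \<le> 1 / c * cL n E)"
      by (intro aas_mono[OF c(2)]) auto
    then show ?thesis using c(1) by (intro exI[of _ "1 / c"]) auto
  qed
  have ii': "\<exists>c>0. \<exists>C>0. aas p (\<lambda>n E. c * (ln (real n) / p n) \<le> cL n E \<and> cL n E \<le> C * (ln (real n) / p n))"
    if "1 / 2 < \<alpha>" "\<alpha> < 1"
  proof -
    obtain c where c: "0 < c" "aas p (\<lambda>n E. c * (ln (real n) / p n) \<le> cL n E)"
      using ii[OF \<open>1 / 2 < \<alpha>\<close> \<open>\<alpha> < 1\<close>] by blast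
    show ?thesis
      by (intro exI[of _ c] conjI exI[of _ 3] aas_conj[OF c(2) upper] c(1)) simp
  qed
  show ?thesis
  proof (intro conjI impI allI)
    show "(\<lambda>n. log (1 / (1 - p n)) (real n)) \<sim>[sequentially] (\<lambda>n. ln (real n) / p n)" if "p \<longlonglongrightarrow> 0"
      by (rule log_inverse_one_minus_asymp[OF that pos])
    show "\<exists>C>0. aas p (\<lambda>n E. 1 / p n \<le> C * cL n E)"
      if "2 \<le> j \<and> 1 / (real j + 1) < \<alpha> \<and> \<alpha> < 1 / real j" for j :: nat
      using that by (intro scale iii) auto
    show "\<exists>C>0. aas p (\<lambda>n E. 1 / (p n * (ln (real n))\<^sup>2) \<le> C * cL n E)"
      if "2 \<le> j \<and> \<alpha> = 1 / real j" for j :: nat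
      using that by (intro scale iv) auto
    show "\<exists>\<delta>::nat \<Rightarrow> real. \<delta> \<longlonglongrightarrow> 0 \<and>
        aas p (\<lambda>n E. \<bar>cL n E - log (1 / (1 - p n)) (real n)\<bar> \<le> \<delta> n * log (1 / (1 - p n)) (real n))"
      if "\<alpha> = 1 \<and> (\<forall>\<^sub>F n in sequentially. p n < 1 - \<epsilon>)"
      by (rule i[OF conjunct1[OF that] conjunct2[OF that]])
    show "\<exists>c>0. \<exists>C>0. aas p (\<lambda>n E. c * (ln (real n) / p n) \<le> cL n E \<and> cL n E \<le> C * (ln (real n) / p n))"
      if "1 / 2 < \<alpha> \<and> \<alpha> < 1"
      by (rule ii'[OF conjunct1[OF that] conjunct2[OF that]])
    show "\<exists>C>0. aas p (\<lambda>n E. cL n E \<le> C * (ln (real n) / p n))" by (rule upper_ex)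
    show "\<exists>C>0. aas p (\<lambda>n E. cL n E \<le> C * (ln (real n) / p n))" by (rule upper_ex)
    assume "\<alpha> = 1 \<and> (\<forall>\<^sub>F n in sequentially. p n < 1 - \<epsilon>) \<or> 1 / 2 < \<alpha> \<and> \<alpha> < 1 \<or>
      (\<exists>j::nat. 2 \<le> j \<and> 1 / (real j + 1) < \<alpha> \<and> \<alpha> < 1 / real j) \<or> (\<exists>j::nat. 2 \<le> j \<and> \<alpha> = 1 / real j)"
    then show "\<exists>\<delta>::nat \<Rightarrow> real. \<delta> \<longlonglongrightarrow> 0 \<and> aas p (\<lambda>n E. real n powr (1 - \<alpha> - \<delta> n) \<le> cL n E \<and>
        cL n E \<le> real n powr (1 - \<alpha> + \<delta> n))"
      by (intro aas_cL_exponent[OF p dens \<alpha>(1)] exponent)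
  qed
qed

end
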